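(* Let $X$ be a complex Banach space, let $A:\operatorname{dom}(A)\subseteq X\to X$ and $B:\operatorname{dom}(B)\subseteq X\to X$ be closed linear operators with $\rho(B)\neq\emptyset$, and let $Y$ be a Banach space continuously embedded in $X$ such that $\operatorname{dom}(A)\subseteq\operatorname{dom}(B^2)\cap Y$, $B(\operatorname{dom}(A))\subseteq Y\subseteq\operatorname{dom}(B)$, and the operator $G=\begin{bmatrix}-B & I \\ A+B^2 & -B\end{bmatrix}$ with domain $\operatorname{dom}(A)\times Y$ generates a $C_0$-group $\{\mathcal T(t)\}_{t\in\mathbb R}$ on $Y\times X$. Then for each $x\in\operatorname{dom}(B)$ and $y\in X$ the initial value problem $$u''(t)+2Bu'(t)=Au(t),\ t\in\mathbb R,\qquad u(0)=x,\ u'(0)=y,$$ has a unique Laplace Transform mild solution, given by $$u(t)=T_{22}(t)x-BT_{12}(t)x+T_{12}(t)(2Bx+y),\qquad t\in\mathbb R.$$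
   Context: The group is written in block form $\mathcal T(t)=\begin{bmatrix}T_{11}(t) & T_{12}(t) \\ T_{21}(t) & T_{22}(t)\end{bmatrix}$ with respect to $Y\times X$, so $T_{11}(t)\in\mathcal B(Y)$, $T_{12}(t)\in\mathcal B(X,Y)$, $T_{21}(t)\in\mathcal B(Y,X)$, $T_{22}(t)\in\mathcal B(X)$. For $\lambda\in\mathbb C$, $Q(\lambda)=\lambda^2I+2\lambda B-A$ with domain $\operatorname{dom}(A)$. For $\nu\in\mathbb R$, $\mathcal C_{-\nu}(\mathbb R,X)=\{f\in\mathcal C(\mathbb R,X):\sup_{t\in\mathbb R}e^{-\nu|t|}\|f(t)\|<\infty\}$ and $\mathbb C_\nu^+=\{\lambda\in\mathbb C:\operatorname{Re}\lambda>\nu\}$. $(\mathcal Lf)(\lambda)=\int_0^\infty e^{-\lambda t}f(t)\,dt$ is the Laplace transform of $f|_{[0,\infty)}$, and $u(-\cdot)$ is the function $t\mapsto u(-t)$. For $x\in\operatorname{dom}(B)$, $y\in X$, a function $u$ belonging to $\mathcal C_{-\nu}(\mathbb R,X)$ for some $\nu$ is a Laplace Transform mild solution if there is $\widetilde\nu>\nu$ such that for every $\lambda\in\mathbb C^+_{\widetilde\nu}$: $(\mathcal Lu)(\lambda),(\mathcal Lu(-\cdot))(\lambda)\in\operatorname{dom}(Q(\lambda))=\operatorname{dom}(A)$ and $$Q(\lambda)(\mathcal Lu)(\lambda)=\lambda x+2Bx+y,\qquad Q(-\lambda)(\mathcal Lu(-\cdot))(\lambda)=\lambda x-2Bx-y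 .$$ *)

theory Defs
  imports "HOL-Analysis.Analysis"
begin

section \<open>Complex Banach spaces\<close>

class complex_normed_vector = real_normed_vector +
  fixes scaleC :: "complex \<Rightarrow> 'a \<Rightarrow> 'a"  (infixr "*\<^sub>C" 75)
  assumes scaleC_add_right: "c *\<^sub>C (x + y) = c *\<^sub>C x + c *\<^sub>C y"
    and scaleC_add_left: "(c + d) *\<^sub>C x = c *\<^sub>C x + d *\<^sub>C x"
    and scaleC_scaleC: "c *\<^sub>C d *\<^sub>C x = (c * d) *\<^sub>C x"
    and scaleC_of_real: "complex_of_real r *\<^sub>C x = r *\<^sub>R x"
    and norm_scaleC: "norm (c *\<^sub>C x) = cmod c * norm x"

class complex_banach = complex_normed_vector + banach

lemma vector_space_scaleC:
  "vector_space (scaleC :: complex \<Rightarrow> 'a \<Rightarrow> 'a :: complex_normed_vector)"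
proof
  fix x :: 'a
  show "1 *\<^sub>C x = x"
    using scaleC_of_real[of 1 x] by simp
qed (simp_all add: scaleC_add_right scaleC_add_left scaleC_scaleC)

instantiation prod :: (complex_normed_vector, complex_normed_vector) complex_normed_vector
begin

definition scaleC_prod :: "complex \<Rightarrow> 'a \<times> 'b \<Rightarrow> 'a \<times> 'b" where
  "scaleC_prod c z = (c *\<^sub>C fst z, c *\<^sub>C snd z)"

instance
proof
  fix c d :: complex and r :: real and z w :: "'a \<times> 'b"
  show "c *\<^sub>C (z + w) = c *\<^sub>C z + c *\<^sub>C w"
    by (simp add: scaleC_prod_def scaleC_add_right)
  show "(c + d) *\<^sub>C z = c *\<^sub>C z + d *\<^sub>C z"
    by (simp add: scaleC_prod_def scaleC_add_left)
  show "c *\<^sub>C d *\<^sub>C z = (c * d) *\<^sub>C z"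
    by (simp add: scaleC_prod_def scaleC_scaleC)
  show "complex_of_real r *\<^sub>C z = r *\<^sub>R z"
    by (simp add: scaleC_prod_def scaleC_of_real scaleR_prod_def)
  have "sqrt ((cmod c * norm (fst z))\<^sup>2 + (cmod c * norm (snd z))\<^sup>2)
      = sqrt ((cmod c)\<^sup>2 * ((norm (fst z))\<^sup>2 + (norm (snd z))\<^sup>2))"
    by (simp add: power_mult_distrib distrib_left)
  then show "norm (c *\<^sub>C z) = cmod c * norm z"
    by (simp add: scaleC_prod_def norm_prod_def norm_scaleC real_sqrt_mult)
qed

end

instance prod :: (complex_banach, complex_banach) complex_banach ..

definition bounded_clinear ::
  "('a::complex_normed_vector \<Rightarrow> 'b::complex_normed_vector) \<Rightarrow> bool" where
  "bounded_clinear f \<longleftrightarrow> bounded_linear f \<and> (\<forall>c x. f (c *\<^sub>C x) = c *\<^sub>C f x)"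


section \<open>Unbounded operators\<close>

text \<open>An operator with domain \<open>D\<close> is given by \<open>D\<close> together with a total function;
  the values of the function outside \<open>D\<close> are irrelevant.\<close>

definition linear_operator ::
  "'a::complex_normed_vector set \<Rightarrow> ('a \<Rightarrow> 'b::complex_normed_vector) \<Rightarrow> bool" where
  "linear_operator D A \<longleftrightarrow> module.subspace scaleC D \<and>
     (\<forall>x\<in>D. \<forall>y\<in>D. A (x + y) = A x + A y) \<and> (\<forall>c. \<forall>x\<in>D. A (c *\<^sub>C x) = c *\<^sub>C A x)"

definition closed_operator ::
  "'a::complex_normed_vector set \<Rightarrow> ('a \<Rightarrow> 'b::complex_normed_vector) \<Rightarrow> bool" where
  "closed_operator D A \<longleftrightarrow> linear_operator D A \<and> closed ((\<lambda>x. (x, A x)) ` D)"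

definition resolvent_set ::
  "'a::complex_normed_vector set \<Rightarrow> ('a \<Rightarrow> 'a) \<Rightarrow> complex set" where
  "resolvent_set D A = {l. bij_betw (\<lambda>x. l *\<^sub>C x - A x) D UNIV \<and>
     bounded_clinear (inv_into D (\<lambda>x. l *\<^sub>C x - A x))}"


section \<open>Strongly continuous groups\<close>

definition C0_group :: "(real \<Rightarrow> 'a::complex_normed_vector \<Rightarrow> 'a) \<Rightarrow> bool" where
  "C0_group T \<longleftrightarrow> (\<forall>t. bounded_clinear (T t)) \<and> T 0 = id \<and>
     (\<forall>s t. T (s + t) = T s \<circ> T t) \<and> (\<forall>z. continuous_on UNIV (\<lambda>t. T t z))"

text \<open>The operator \<open>G\<close> with domain \<open>D\<close> is the infinitesimal generator of \<open>T\<close>: \<open>D\<close> consists of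
  all \<open>z\<close> for which the limit exists, not just of some of them.\<close>

definition generates_C0_group ::
  "'a::complex_normed_vector set \<Rightarrow> ('a \<Rightarrow> 'a) \<Rightarrow> (real \<Rightarrow> 'a \<Rightarrow> 'a) \<Rightarrow> bool" where
  "generates_C0_group D G T \<longleftrightarrow> C0_group T \<and>
     (\<forall>z w. ((\<lambda>h. (T h z - z) /\<^sub>R h) \<longlongrightarrow> w) (at 0) \<longleftrightarrow> z \<in> D \<and> w = G z)"


section \<open>Laplace Transform mild solutions\<close>

text \<open>\<open>growth_space \<nu>\<close> is the space written \<open>C\<close> with subscript \<open>-\<nu>\<close>, of continuous functions
  bounded by a multiple of \<open>exp (\<nu> * \<bar>t\<bar>)\<close>.\<close>

definition growth_space :: "real \<Rightarrow> (real \<Rightarrow> 'a::real_normed_vector) set" where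
  "growth_space \<nu> = {f. continuous_on UNIV f \<and>
     bdd_above (range (\<lambda>t. exp (- \<nu> * \<bar>t\<bar>) * norm (f t)))}"

definition laplace :: "(real \<Rightarrow> 'a::complex_banach) \<Rightarrow> complex \<Rightarrow> 'a" where
  "laplace f l = integral {0..} (\<lambda>t. exp (- l * complex_of_real t) *\<^sub>C f t)"

definition quad_pencil ::
  "('a::complex_normed_vector \<Rightarrow> 'a) \<Rightarrow> ('a \<Rightarrow> 'a) \<Rightarrow> complex \<Rightarrow> 'a \<Rightarrow> 'a" where
  "quad_pencil A B l x = l\<^sup>2 *\<^sub>C x + (2 * l) *\<^sub>C B x - A x"

definition LT_mild_solution ::
  "'a::complex_banach set \<Rightarrow> ('a \<Rightarrow> 'a) \<Rightarrow> ('a \<Rightarrow> 'a) \<Rightarrow> 'a \<Rightarrow> 'a \<Rightarrow> (real \<Rightarrow> 'a) \<Rightarrow> bool" where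
  "LT_mild_solution domA A B x y u \<longleftrightarrow>
     (\<exists>\<nu>. u \<in> growth_space \<nu> \<and>
       (\<exists>\<nu>'>\<nu>. \<forall>l. Re l > \<nu>' \<longrightarrow>
          laplace u l \<in> domA \<and> laplace (\<lambda>t. u (- t)) l \<in> domA \<and>
          quad_pencil A B l (laplace u l) = l *\<^sub>C x + 2 *\<^sub>C B x + y \<and>
          quad_pencil A B (- l) (laplace (\<lambda>t. u (- t)) l) = l *\<^sub>C x - 2 *\<^sub>C B x - y))"


section \<open>The block operator on \<open>Y \<times> X\<close>\<close>

text \<open>The continuously embedded space \<open>Y\<close> is a type of its own with an injective bounded linear
  map \<open>j\<close> into \<open>X\<close>; as a subset of \<open>X\<close> it is \<open>range j\<close>.  The first component of \<open>block_op\<close>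
  is computed in \<open>X\<close> and pulled back along \<open>j\<close>, which is meaningful
  when \<open>B\<close> maps \<open>dom A\<close> into \<open>range j\<close>.\<close>

definition continuous_embedding ::
  "('y::complex_normed_vector \<Rightarrow> 'x::complex_normed_vector) \<Rightarrow> bool" where
  "continuous_embedding j \<longleftrightarrow> bounded_clinear j \<and> inj j"

definition block_dom :: "('y \<Rightarrow> 'x) \<Rightarrow> 'x set \<Rightarrow> ('y \<times> 'x) set" where
  "block_dom j domA = {(a, b). j a \<in> domA \<and> b \<in> range j}"

definition block_op ::
  "('y \<Rightarrow> 'x::complex_normed_vector) \<Rightarrow> ('x \<Rightarrow> 'x) \<Rightarrow> ('x \<Rightarrow> 'x) \<Rightarrow> 'y \<times> 'x \<Rightarrow> 'y \<times> 'x" where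
  "block_op j A B = (\<lambda>(a, b). (inv j (- B (j a) + b), A (j a) + B (B (j a)) - B b))"

definition block12 :: "(real \<Rightarrow> 'y::zero \<times> 'x \<Rightarrow> 'y \<times> 'x) \<Rightarrow> real \<Rightarrow> 'x \<Rightarrow> 'y" where
  "block12 T t x = fst (T t (0, x))"

definition block22 :: "(real \<Rightarrow> 'y::zero \<times> 'x \<Rightarrow> 'y \<times> 'x) \<Rightarrow> real \<Rightarrow> 'x \<Rightarrow> 'x" where
  "block22 T t x = snd (T t (0, x))"

end

theory Submission
  imports Defs
begin

text \<open>For \<open>Re l\<close> beyond the growth bound of the group, the Laplace transform of the orbit of \<open>(0, z)\<close>
  under \<open>T\<close> is \<open>(l - G)\<^sup>-\<^sup>1 (0, z)\<close>. Written in components \<open>(a, b)\<close> this says \<open>b = l a + B a\<close> and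
  \<open>Q(l) a = z\<close>, so that the transform of \<open>T\<^sub>2\<^sub>2 x - B T\<^sub>1\<^sub>2 x\<close> is \<open>l Q(l)\<^sup>-\<^sup>1 x\<close> and that of the
  claimed solution is \<open>Q(l)\<^sup>-\<^sup>1 (l x + 2 B x + y)\<close>; the reversed group \<open>T(-t)\<close> gives the condition at
  \<open>- l\<close>. Here \<open>B\<close> may be interchanged with the integral because \<open>B\<close> is bounded from \<open>Y\<close> to \<open>X\<close> by
  the closed graph theorem. For uniqueness, a vector \<open>a\<close> in the kernel of \<open>Q(l)\<close> gives an
  eigenvector \<open>(a, l a + B a)\<close> of \<open>G\<close> for \<open>l\<close>, whose orbit grows too fast; hence two mild
  solutions have the same Laplace transforms, which determine them on both half-lines.\<close>

section \<open>Consequences of the Baire category theorem\<close>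

text \<open>Zabreiko's lemma; both the closed graph theorem and uniform boundedness are instances, with
  \<open>p x = norm (f x)\<close> and \<open>p x = (SUP t. norm (T t x))\<close>. By Baire, some closure of \<open>{x. p x \<le> n}\<close>
  contains a ball; successive approximation from that sublevel set then writes each vector as a
  series to which countable subadditivity applies.\<close>

lemma countably_subadditive_seminorm_bounded:
  fixes p :: "'a::banach \<Rightarrow> real"
  assumes nonneg: "\<And>x. 0 \<le> p x"
    and add: "\<And>x y. p (x + y) \<le> p x + p y"
    and scale: "\<And>c x. p (c *\<^sub>R x) = \<bar>c\<bar> * p x"
    and countable: "\<And>f s. f sums s \<Longrightarrow> summable (\<lambda>n. p (f n)) \<Longrightarrow> p s \<le> (\<Sum>n. p (f n))"
  obtains C where "C \<ge> 0" "\<And>x. p x \<le> C * norm x"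
proof -
  define A where "A n = {x. p x \<le> real n}" for n
  have p0: "p 0 = 0" using scale[of 0 0] by simp
  have pm: "p (- x) = p x" for x using scale[of "-1" x] by simp
  have "\<exists>n. interior (closure (A n)) \<noteq> {}"
  proof (rule ccontr)
    assume "\<nexists>n. interior (closure (A n)) \<noteq> {}"
    then have "(euclidean :: 'a topology) interior_of \<Union>(range (\<lambda>n. closure (A n))) = {}"
      by (intro Baire_category_alt) (auto simp: completely_metrizable_space_euclidean)
    moreover have "x \<in> \<Union>(range (\<lambda>n. closure (A n)))" for x
    proof -
      have "x \<in> A (nat \<lceil>p x\<rceil>)" using nonneg[of x] by (simp add: A_def)
      then show ?thesis using closure_subset by fastforce
    qed
    then have "\<Union>(range (\<lambda>n. closure (A n))) = UNIV" by blast
    ultimately show False by simp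
  qed
  then obtain n x0 where "x0 \<in> interior (closure (A n))" by blast
  then obtain r where r: "r > 0" "ball x0 r \<subseteq> closure (A n)"
    using mem_interior by blast
  \<comment> \<open>Recentring at 0: \<open>y\<close> is half the difference of
    \<open>x0 + y\<close> and \<open>x0 - y\<close>, and \<open>A n\<close> is stable under
    half-differences.\<close>
  have near0: "y \<in> closure (A n)" if "norm y < r" for y
  proof -
    have "x0 + y \<in> closure (A n)" "x0 - y \<in> closure (A n)"
      using that r(2) by (auto simp: subset_iff dist_norm)
    then obtain a b where ab: "\<And>k. a k \<in> A n" "a \<longlonglongrightarrow> x0 + y" "\<And>k. b k \<in> A n" "b \<longlonglongrightarrow> x0 - y"
      unfolding closure_sequential by metis
    have "(1/2) *\<^sub>R (a k - b k) \<in> A n" for k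
      using add[of "a k" "- b k"] ab(1)[of k] ab(3)[of k] by (simp add: A_def scale pm)
    moreover have "(\<lambda>k. (1/2) *\<^sub>R (a k - b k)) \<longlonglongrightarrow> (1/2) *\<^sub>R ((x0 + y) - (x0 - y))"
      by (intro tendsto_intros ab)
    ultimately show ?thesis
      unfolding closure_sequential
      by (intro exI[of _ "\<lambda>k. (1/2) *\<^sub>R (a k - b k)"]) (auto simp flip: scaleR_2)
  qed
  \<comment> \<open>Scaling by \<open>2^k\<close> moves \<open>x\<close> into the ball of radius
    \<open>r\<close>; approximating there within \<open>r / 2\<close> and scaling back halves the
    error bound.\<close>
  have approx: "\<exists>a. p a \<le> real n / 2^k \<and> norm (x - a) < r / 2 ^ Suc k" if "norm x < r / 2^k" for x k
  proof -
    have "norm (2^k *\<^sub>R x) < r" using that by (simp add: field_simps)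
    then obtain a where a: "a \<in> A n" "dist a (2^k *\<^sub>R x) < r / 2"
      using near0 r(1) unfolding closure_approachable by (meson half_gt_zero)
    have "x - (1/2^k) *\<^sub>R a = (1/2^k) *\<^sub>R (2^k *\<^sub>R x - a)"
      by (simp add: scaleR_diff_right)
    then have "norm (x - (1/2^k) *\<^sub>R a) = dist a (2^k *\<^sub>R x) / 2^k"
      by (simp add: dist_norm norm_minus_commute)
    then have "norm (x - (1/2^k) *\<^sub>R a) < r / 2 ^ Suc k"
      using a(2) by (simp add: field_simps)
    moreover have "p ((1/2^k) *\<^sub>R a) \<le> real n / 2^k"
      using a(1) by (simp add: A_def scale field_simps)
    ultimately show ?thesis by blast
  qed
  then have "\<forall>k x. \<exists>a. norm x < r / 2^k \<longrightarrow> p a \<le> real n / 2^k \<and> norm (x - a) < r / 2 ^ Suc k"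
    by blast
  then obtain a where "\<forall>k x. norm x < r / 2^k \<longrightarrow> p (a k x) \<le> real n / 2^k \<and> norm (x - a k x) < r / 2 ^ Suc k"
    unfolding choice_iff by blast
  then have a: "\<And>k x. norm x < r / 2^k \<Longrightarrow> p (a k x) \<le> real n / 2^k"
      "\<And>k x. norm x < r / 2^k \<Longrightarrow> norm (x - a k x) < r / 2 ^ Suc k"
    by blast+
  have bound: "p x \<le> 2 * real n" if "norm x < r" for x
  proof -
    \<comment> \<open>\<open>X k\<close> is the remainder after \<open>k\<close> successive
      approximations, so the partial sums telescope to \<open>x - X m\<close>.\<close>
    define X where "X = rec_nat x (\<lambda>k z. z - a k z)"
    have X: "X 0 = x" "\<And>k. X (Suc k) = X k - a k (X k)" by (simp_all add: X_def)
    have Xn: "norm (X k) < r / 2^k" for k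
    proof (induction k)
      case (Suc k) then show ?case using a(2)[OF Suc] by (simp only: X)
    qed (use that X in simp)
    have part: "(\<Sum>k<m. a k (X k)) = x - X m" for m
      by (induction m) (simp_all add: X)
    have geo: "(\<lambda>k. c / 2^k) sums (2 * c)" for c :: real
      using sums_mult[OF geometric_sums[of "1/2::real"], of c]
      by (simp add: power_one_over field_simps)
    have "(\<lambda>m. r / 2^m) \<longlonglongrightarrow> 0" using geo sums_summable summable_LIMSEQ_zero by blast
    then have "X \<longlonglongrightarrow> 0"
      by (rule Lim_null_comparison[rotated]) (use Xn less_imp_le in \<open>auto intro!: always_eventually\<close>)
    then have "(\<lambda>m. x - X m) \<longlonglongrightarrow> x - 0" by (intro tendsto_intros)
    then have S: "(\<lambda>k. a k (X k)) sums x" by (simp add: sums_def part)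
    have le: "p (a k (X k)) \<le> real n / 2^k" for k using a(1) Xn by blast
    have sm: "summable (\<lambda>k. p (a k (X k)))"
      by (rule summable_comparison_test'[OF sums_summable[OF geo[of "real n"]], of 0])
        (use le nonneg in auto)
    have "p x \<le> (\<Sum>k. p (a k (X k)))" by (rule countable[OF S sm])
    also have "\<dots> \<le> (\<Sum>k. real n / 2^k)" by (intro suminf_le le sm sums_summable[OF geo])
    finally show ?thesis using geo[of "real n"] sums_unique by metis
  qed
  show thesis
  \<comment> \<open>A nonzero \<open>x\<close> is rescaled to norm \<open>r / 2\<close>, where
    \<open>p\<close> is at most \<open>2 * n\<close>; this gives the factor
    \<open>4 * n / r\<close>.\<close>
  proof (rule that[of "4 * real n / r"])
    fix x
    show "p x \<le> 4 * real n / r * norm x"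
    proof (cases "x = 0")
      case False
      have "p ((r / (2 * norm x)) *\<^sub>R x) \<le> 2 * real n"
        by (rule bound) (use False r(1) in simp)
      then show ?thesis using False r(1) by (simp add: scale field_simps)
    qed (simp add: p0)
  qed (use r in simp)
qed

text \<open>Closedness of the graph yields countable subadditivity of \<open>norm (f x)\<close>: if
  the values \<open>f (g n)\<close> are absolutely summable, the pairs of partial sums converge
  within the graph, which identifies \<open>f s\<close> with the sum of the values.\<close>

lemma closed_graph_theorem:
  fixes f :: "'a::banach \<Rightarrow> 'b::banach"
  assumes "linear f" and "closed (range (\<lambda>x. (x, f x)))"
  shows "bounded_linear f"
proof -
  obtain C where C: "C \<ge> 0" "\<And>x. norm (f x) \<le> C * norm x"
  proof (rule countably_subadditive_seminorm_bounded[of "\<lambda>x. norm (f x)"])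
    fix g s assume g: "g sums s" and sm: "summable (\<lambda>n. norm (f (g n)))"
    have "(\<lambda>n. f (g n)) sums (\<Sum>n. f (g n))"
      by (rule summable_sums[OF summable_norm_cancel[OF sm]])
    then have "(\<lambda>n. (\<Sum>i<n. g i, f (\<Sum>i<n. g i))) \<longlonglongrightarrow> (s, \<Sum>n. f (g n))"
      using g unfolding sums_def by (auto intro!: tendsto_Pair simp: linear_sum[OF assms(1)])
    then have "(s, \<Sum>n. f (g n)) \<in> range (\<lambda>x. (x, f x))"
      by (rule closed_sequentially[OF assms(2), rotated]) auto
    then have "f s = (\<Sum>n. f (g n))" by auto
    then show "norm (f s) \<le> (\<Sum>n. norm (f (g n)))"
      using summable_norm[OF sm] by simp
  qed (simp_all add: linear_add[OF assms(1)] linear_scale[OF assms(1)] norm_triangle_ineq)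
  show ?thesis
    using assms(1) C(2) by (auto simp: bounded_linear_def bounded_linear_axioms_def mult.commute)
qed

text \<open>By continuity each \<open>norm (T t z)\<close> is countably subadditive, and the
  supremum over \<open>K\<close>, finite by pointwise boundedness, inherits this.\<close>

lemma uniform_boundedness:
  fixes T :: "'i \<Rightarrow> 'a::banach \<Rightarrow> 'b::banach"
  assumes lin: "\<And>t. t \<in> K \<Longrightarrow> bounded_linear (T t)"
    and bdd: "\<And>z. bounded ((\<lambda>t. T t z) ` K)" and ne: "K \<noteq> {}"
  obtains C where "C \<ge> 0" "\<And>t z. t \<in> K \<Longrightarrow> norm (T t z) \<le> C * norm z"
proof -
  define p where "p z = (SUP t\<in>K. norm (T t z))" for z
  have bd: "bdd_above ((\<lambda>t. norm (T t z)) ` K)" for z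
    by (intro bounded_imp_bdd_above) (simp add: bounded_norm_comp bdd)
  have up: "norm (T t z) \<le> p z" if "t \<in> K" for t z
    unfolding p_def by (intro cSUP_upper that bd)
  have le: "p z \<le> c" if "\<And>t. t \<in> K \<Longrightarrow> norm (T t z) \<le> c" for z c
    unfolding p_def using ne that by (intro cSUP_least) auto
  have nn: "0 \<le> p z" for z using ne up norm_ge_zero order_trans by blast
  have sc_le: "p (c *\<^sub>R z) \<le> \<bar>c\<bar> * p z" for c z
    by (rule le) (simp add: linear_scale bounded_linear.linear lin up mult_left_mono)
  have sc: "p (c *\<^sub>R z) = \<bar>c\<bar> * p z" for c z
  proof (cases "c = 0")
    case True then show ?thesis using sc_le[of c z] nn[of "c *\<^sub>R z"] by simp
  next
    case False
    \<comment> \<open>The reverse inequality is \<open>sc_le\<close> for the factor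
      \<open>1 / c\<close> at the vector \<open>c *\<^sub>R z\<close>.\<close>
    then show ?thesis using sc_le[of c z] sc_le[of "1/c" "c *\<^sub>R z"] by (simp add: field_simps)
  qed
  obtain C where C: "C \<ge> 0" "\<And>z. p z \<le> C * norm z"
  proof (rule countably_subadditive_seminorm_bounded[of p])
    fix x y show "p (x + y) \<le> p x + p y"
    proof (rule le)
      fix t assume t: "t \<in> K"
      have "norm (T t x + T t y) \<le> p x + p y"
        by (intro norm_triangle_le add_mono up t)
      then show "norm (T t (x + y)) \<le> p x + p y"
        using lin[OF t] by (simp add: linear_add bounded_linear.linear)
    qed
  next
    fix f s assume f: "f sums s" and sm: "summable (\<lambda>n. p (f n))"
    show "p s \<le> (\<Sum>n. p (f n))"
    proof (rule le)
      fix t assume t: "t \<in> K"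
      have 1: "(\<lambda>n. T t (f n)) sums T t s"
        using bounded_linear.sums[OF lin[OF t] f] .
      have 2: "summable (\<lambda>n. norm (T t (f n)))"
        by (rule summable_comparison_test'[OF sm, of 0]) (use up t in auto)
      have "norm (T t s) \<le> (\<Sum>n. norm (T t (f n)))"
        using summable_norm[OF 2] sums_unique[OF 1] by simp
      also have "\<dots> \<le> (\<Sum>n. p (f n))" by (intro suminf_le 2 sm up t)
      finally show "norm (T t s) \<le> (\<Sum>n. p (f n))" .
    qed
  qed (auto simp: nn sc)
  show thesis using that[of C] C up order_trans by blast
qed

text \<open>Strong continuity on the compact interval from -1 to 1 and uniform boundedness give one
  constant there; \<open>n\<close> steps of length at most 1 turn it into an exponential bound with
  rate \<open>ln K\<close>.\<close>

lemma C0_group_growth_bound: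
  fixes T :: "real \<Rightarrow> 'a::complex_banach \<Rightarrow> 'a"
  assumes T: "C0_group T"
  obtains M w where "\<And>t z. norm (T t z) \<le> M * exp (w * \<bar>t\<bar>) * norm z" "M \<ge> 1" "w \<ge> 0"
proof -
  have lin: "bounded_linear (T t)" for t using T by (auto simp: C0_group_def bounded_clinear_def)
  have T0: "T 0 = id" and Tadd: "T (s + t) = T s \<circ> T t" for s t using T by (auto simp: C0_group_def)
  have bd: "bounded ((\<lambda>t. T t z) ` {-1..1})" for z
    using T by (intro compact_imp_bounded compact_continuous_image)
      (auto simp: C0_group_def intro: continuous_on_subset)
  obtain C where C: "C \<ge> 0" "\<And>t z. t \<in> {-1..1} \<Longrightarrow> norm (T t z) \<le> C * norm z"
    using uniform_boundedness[of "{-1..1}" T, OF lin bd] by auto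
  \<comment> \<open>Raising the constant to at least 1 makes the rate \<open>ln K\<close>
    nonnegative.\<close>
  define K where "K = max C 1"
  have K: "norm (T t z) \<le> K * norm z" if "\<bar>t\<bar> \<le> 1" for t z
    using C(2)[of t z] that mult_right_mono[of C K "norm z"] by (auto simp: K_def abs_le_iff)
  have K1: "K \<ge> 1" by (simp add: K_def)
  have pow: "norm (T (real n * s) z) \<le> K ^ n * norm z" if s: "\<bar>s\<bar> \<le> 1" for n s z
  proof (induction n)
    case (Suc n)
    have "norm (T (real (Suc n) * s) z) = norm (T s (T (real n * s) z))"
      using Tadd[of s "real n * s"] by (simp add: distrib_right)
    also have "\<dots> \<le> K * (K ^ n * norm z)"
      using K[OF s] Suc K1 by (meson mult_left_mono order_trans zero_le_one)
    finally show ?case by simp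
  qed (simp add: T0)
  show thesis
  proof (rule that[of K "ln K"])
    fix t :: real and z
    \<comment> \<open>The successor keeps \<open>n\<close> positive at \<open>t = 0\<close> and at
      least \<bar>t\<bar>, so that \<open>t / n\<close> has modulus at most 1; the excess of at most
      1 costs one factor \<open>K\<close>.\<close>
    define n where "n = Suc (nat \<lfloor>\<bar>t\<bar>\<rfloor>)"
    have n: "\<bar>t\<bar> \<le> real n" "real n \<le> \<bar>t\<bar> + 1" "n > 0" unfolding n_def by (auto, linarith+)
    have "norm (T t z) \<le> K ^ n * norm z"
      using pow[of "t / real n" n z] n by (simp add: field_simps)
    also have "K ^ n = exp (ln K * real n)" using K1 by (simp add: exp_of_nat2_mult)
    also have "\<dots> \<le> exp (ln K * (\<bar>t\<bar> + 1))" using n K1 by (simp add: mult_left_mono)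
    also have "\<dots> = K * exp (ln K * \<bar>t\<bar>)" using K1 by (simp add: distrib_left exp_add)
    finally show "norm (T t z) \<le> K * exp (ln K * \<bar>t\<bar>) * norm z"
      by (simp add: mult_right_mono)
  qed (use K1 in auto)
qed

section \<open>Vector-valued integrals over half-lines\<close>

text \<open>Cauchy criterion: continuity gives the integrals over compact intervals, and their
  differences are dominated by those of \<open>g\<close>, whose improper integral exists. Only norms
  are compared, so any Banach space is allowed as target.\<close>

lemma integrable_on_atLeast_dominated:
  fixes f :: "real \<Rightarrow> 'a::banach" and g :: "real \<Rightarrow> real"
  assumes cont: "continuous_on {c..} f" and g: "g integrable_on {c..}"
    and le: "\<And>t. t \<ge> c \<Longrightarrow> norm (f t) \<le> g t"
  shows "f integrable_on {c..}"
proof -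
  \<comment> \<open>The criterion for unbounded domains concerns boxes and extension by 0; these
    facts reduce such integrals to integrals over \<open>{max a c..b}\<close>.\<close>
  have restr: "((\<lambda>x. if x \<in> {c..} then h x else 0) integrable_on {a..b}) = (h integrable_on {max a c..b})"
      "integral {a..b} (\<lambda>x. if x \<in> {c..} then h x else 0) = integral {max a c..b} h"
    for h :: "real \<Rightarrow> 'b::banach" and a b
  proof -
    have "{c..} \<inter> {a..b} = {max a c..b}" by auto
    then show "((\<lambda>x. if x \<in> {c..} then h x else 0) integrable_on {a..b}) = (h integrable_on {max a c..b})"
      "integral {a..b} (\<lambda>x. if x \<in> {c..} then h x else 0) = integral {max a c..b} h"
      by (simp_all only: integrable_restrict_Int integral_restrict_Int)
  qed
  have fi: "f integrable_on {a..b}" if "a \<ge> c" for a b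
    by (rule integrable_continuous_interval) (use cont that in \<open>auto intro: continuous_on_subset\<close>)
  have gi: "g integrable_on {a..b}" if "a \<ge> c" for a b
    using integrable_on_subinterval[OF g, of a b] that by auto
  have tail: "norm (integral {c..b} f - integral {c..d} f) \<le> \<bar>integral {c..b} g - integral {c..d} g\<bar>"
    if "c \<le> b" "b \<le> d" for b d
  proof -
    have "integral {c..b} f + integral {b..d} f = integral {c..d} f"
      by (intro Henstock_Kurzweil_Integration.integral_combine fi that order_refl)
    moreover have "integral {c..b} g + integral {b..d} g = integral {c..d} g"
      by (intro Henstock_Kurzweil_Integration.integral_combine gi that order_refl)
    ultimately have "integral {c..b} f - integral {c..d} f = - integral {b..d} f"
        "integral {c..b} g - integral {c..d} g = - integral {b..d} g"
      by (simp_all add: algebra_simps)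
    moreover have "norm (integral {b..d} f) \<le> integral {b..d} g"
      by (rule integral_norm_bound_integral) (use that in \<open>auto intro: fi gi le\<close>)
    ultimately show ?thesis by simp
  qed
  show ?thesis
  proof (subst integrable_alt, intro conjI allI impI)
    show "(\<lambda>x. if x \<in> {c..} then f x else 0) integrable_on cbox a b" for a b
      by (simp only: cbox_interval restr) (rule fi, simp)
    fix e :: real assume "e > 0"
    then obtain B where B: "B > 0" "\<And>a b a' d :: real. ball 0 B \<subseteq> cbox a b \<and> ball 0 B \<subseteq> cbox a' d \<Longrightarrow>
      norm (integral (cbox a b) (\<lambda>x. if x \<in> {c..} then g x else 0) -
      integral (cbox a' d)  (\<lambda>x. if x \<in> {c..} then g x else 0)) < e"
      using g[THEN integrable_alt[THEN iffD1], THEN conjunct2] by meson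
    show "\<exists>B>0. \<forall>a b a' d :: real. ball 0 B \<subseteq> cbox a b \<and> ball 0 B \<subseteq> cbox a' d \<longrightarrow>
      norm (integral (cbox a b) (\<lambda>x. if x \<in> {c..} then f x else 0) -
      integral (cbox a' d)  (\<lambda>x. if x \<in> {c..} then f x else 0)) < e"
    \<comment> \<open>The radius \<bar>c\<bar> + 1 forces \<open>c\<close> into both boxes, so both
      are cut off at \<open>c\<close> and only the right endpoints matter.\<close>
    proof (intro exI[of _ "max B (\<bar>c\<bar> + 1)"] conjI allI impI)
      fix a b a' d :: real assume sub: "ball 0 (max B (\<bar>c\<bar> + 1)) \<subseteq> cbox a b \<and> ball 0 (max B (\<bar>c\<bar> + 1)) \<subseteq> cbox a' d"
      have "c \<in> ball 0 (max B (\<bar>c\<bar> + 1))" by auto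
      then have c: "a \<le> c" "c \<le> b" "a' \<le> c" "c \<le> d" using sub by auto
      have "ball 0 B \<subseteq> ball 0 (max B (\<bar>c\<bar> + 1))" for B :: real by auto
      then have "ball 0 B \<subseteq> cbox a b \<and> ball 0 B \<subseteq> cbox a' d" using sub by (auto simp: subset_iff)
      from B(2)[OF this] have less: "\<bar>integral {c..b} g - integral {c..d} g\<bar> < e"
        using c by (simp only: cbox_interval restr max_absorb2 real_norm_def)
      have "norm (integral {c..b} f - integral {c..d} f) < e"
      proof (cases "b \<le> d")
        case True then show ?thesis using tail[of b d] c less by linarith
      next
        case False
        then have "norm (integral {c..d} f - integral {c..b} f) \<le> \<bar>integral {c..d} g - integral {c..b} g\<bar>"
          using tail[of d b] c by simp
        then show ?thesis using less norm_minus_commute[of "integral {c..d} f" "integral {c..b} f"] by linarith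
      qed
      then show "norm (integral (cbox a b) (\<lambda>x. if x \<in> {c..} then f x else 0) -
        integral (cbox a' d)  (\<lambda>x. if x \<in> {c..} then f x else 0)) < e"
        using c by (simp only: cbox_interval restr max_absorb2)
    qed (use B in simp)
  qed
qed

lemma integrable_on_atLeast_exp_bounded:
  fixes f :: "real \<Rightarrow> 'a::banach"
  assumes "continuous_on {c..} f" and "k > 0" and "\<And>t. t \<ge> c \<Longrightarrow> norm (f t) \<le> C * exp (- k * t)"
  shows "f integrable_on {c..}"
proof (rule integrable_on_atLeast_dominated[OF assms(1) _ assms(3)])
  show "(\<lambda>t. C * exp (- k * t)) integrable_on {c..}"
    by (rule integrable_on_mult_right[OF integrable_on_exp_minus_to_infinity[OF assms(2)]])
qed

lemma has_integral_shift_UNIV_real: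
  fixes f :: "real \<Rightarrow> 'a::banach"
  assumes "(f has_integral L) UNIV"
  shows "((\<lambda>t. f (t + h)) has_integral L) UNIV"
proof -
  have sh: "integral {a..b} (\<lambda>t. f (t + h)) = integral {a+h..b+h} f" for a b
    using integral_shift_real_ivl[of "a+h" h "b+h" f] by simp
  show ?thesis
    unfolding has_integral_alt'
  proof (intro conjI allI impI)
    show "(\<lambda>x. if x \<in> UNIV then f (x + h) else 0) integrable_on cbox a b" for a b
      using integrable_shift_real_ivl[of f "a+h" "b+h" h] integrable_on_subinterval[OF has_integral_integrable[OF assms], of "a+h" "b+h"]
      by simp
    fix e :: real assume "e > 0"
    then obtain B where B: "B > 0" "\<And>a b :: real. ball 0 B \<subseteq> cbox a b \<Longrightarrow>
            norm (integral (cbox a b) f - L) < e"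
      using assms unfolding has_integral_alt'[of f] by (simp only: UNIV_I if_True) blast
    show "\<exists>B>0. \<forall>a b. ball 0 B \<subseteq> cbox a b \<longrightarrow>
            norm (integral (cbox a b) (\<lambda>x. if x \<in> UNIV then f (x+h) else 0) - L) < e"
    \<comment> \<open>Enlarging the radius by \<bar>h\<bar> keeps the ball of radius
      \<open>B\<close> inside the box after translation by \<open>h\<close>.\<close>
    proof (intro exI[of _ "B + \<bar>h\<bar>"] conjI allI impI)
      fix a b :: real assume sub: "ball 0 (B + \<bar>h\<bar>) \<subseteq> cbox a b"
      have "ball 0 B \<subseteq> cbox (a + h) (b + h)"
      proof
        fix x :: real assume "x \<in> ball 0 B"
        then have "x - h \<in> ball 0 (B + \<bar>h\<bar>)" by (auto simp: dist_norm)
        then have "x - h \<in> cbox a b" using sub by blast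
        then show "x \<in> cbox (a + h) (b + h)" by auto
      qed
      from B(2)[OF this] show "norm (integral (cbox a b) (\<lambda>x. if x \<in> UNIV then f (x+h) else 0) - L) < e"
        by (simp add: sh)
    qed (use B in auto)
  qed
qed

lemma has_integral_shift_atLeast:
  fixes f :: "real \<Rightarrow> 'a::banach"
  assumes "(f has_integral L) {h..}"
  shows "((\<lambda>t. f (t + h)) has_integral L) {0..}"
proof -
  have "((\<lambda>t. if t \<in> {h..} then f t else 0) has_integral L) UNIV"
    using assms by (simp only: has_integral_restrict_UNIV)
  from has_integral_shift_UNIV_real[OF this, of h]
  have "((\<lambda>t. if t \<in> {0..} then f (t + h) else 0) has_integral L) UNIV"
    by simp
  then show ?thesis by (simp only: has_integral_restrict_UNIV)
qed

text \<open>Splitting at -1 writes the tail as a constant minus an integral for which 0 is an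
  interior upper limit; the fundamental theorem then gives a two-sided derivative.\<close>

lemma integral_atLeast_has_vector_derivative:
  fixes f :: "real \<Rightarrow> 'a::banach"
  assumes cont: "continuous_on UNIV f" and int: "\<And>c. f integrable_on {c..}"
  shows "((\<lambda>h. integral {h..} f) has_vector_derivative - f 0) (at 0)"
proof -
  have fi: "f integrable_on {a..b}" for a b
    by (rule integrable_continuous_interval) (use cont in \<open>auto intro: continuous_on_subset\<close>)
  have eq: "integral {h..} f = integral {-1..} f - integral {-1..h} f" if "h \<ge> -1" for h
  proof -
    have "(f has_integral (integral {-1..h} f + integral {h..} f)) ({-1..h} \<union> {h..})"
      by (rule has_integral_Un) (use fi int that in \<open>auto simp: integrable_integral intro: negligible_subset[of "{h}"]\<close>)
    moreover have "{-1..h} \<union> {h..} = {-1..}" using that by auto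
    ultimately show ?thesis by (simp add: integral_unique)
  qed
  have "((\<lambda>h. integral {-1..h} f) has_vector_derivative f 0) (at 0 within {-1..1})"
    by (rule integral_has_vector_derivative) (use cont in \<open>auto intro: continuous_on_subset\<close>)
  then have "((\<lambda>h. integral {-1..h} f) has_vector_derivative f 0) (at 0)"
    by (subst (asm) at_within_interior) auto
  then have "((\<lambda>h. integral {-1..} f - integral {-1..h} f) has_vector_derivative 0 - f 0) (at 0)"
    by (intro has_vector_derivative_diff has_vector_derivative_const)
  then have "((\<lambda>h. integral {-1..} f - integral {-1..h} f) has_vector_derivative - f 0) (at 0)" by simp
  then show ?thesis
    by (rule has_vector_derivative_transform_within_open[of _ _ _ "{-1<..<1}"]) (auto intro!: eq[symmetric])
qed

text \<open>In the variable \<open>exp (- t)\<close> the hypothesis says that all moments vanish. Weierstrass approximation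
  extends this to all continuous weights, and a bump concentrated at a point where \<open>h\<close> is nonzero
  contradicts it; this avoids the Hahn--Banach theorem for vector-valued \<open>h\<close>.\<close>

lemma integral_exp_moments_eq_zero:
  fixes h :: "real \<Rightarrow> 'a::banach"
  assumes cont: "continuous_on {0..} h" and bound: "\<And>t. t \<ge> 0 \<Longrightarrow> norm (h t) \<le> C * exp (- t)"
    and zero: "\<And>n. integral {0..} (\<lambda>t. exp (- real n * t) *\<^sub>R h t) = 0"
    and t: "t \<ge> 0"
  shows "h t = 0"
proof -
  have C0: "C \<ge> 0" using bound[of 0] norm_ge_zero[of "h 0"] by (simp del: norm_ge_zero)
  have expint: "(\<lambda>t. c * exp (- t)) integrable_on {0..}" "integral {0..} (\<lambda>t. c * exp (- t)) = c" for c :: real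
    using has_integral_mult_right[OF has_integral_exp_minus_to_infinity[of 1 0], of c]
    by (auto simp: has_integral_iff)
  have intw: "(\<lambda>t. \<phi> (exp (- t)) *\<^sub>R h t) integrable_on {0..}" if \<phi>: "continuous_on {0..1} \<phi>" for \<phi> :: "real \<Rightarrow> real"
  proof -
    obtain D where D: "\<And>x. x \<in> {0..1} \<Longrightarrow> \<bar>\<phi> x\<bar> \<le> D"
      using compact_imp_bounded[OF compact_continuous_image[OF \<phi> compact_Icc]]
      by (force simp: bounded_iff)
    show ?thesis
    proof (rule integrable_on_atLeast_exp_bounded[of _ _ 1 "D * C"])
      show "continuous_on {0..} (\<lambda>t. \<phi> (exp (- t)) *\<^sub>R h t)"
        by (intro continuous_intros continuous_on_compose2[OF \<phi>] cont) auto
      fix t :: real assume t: "t \<ge> 0"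
      have "\<bar>\<phi> (exp (- t))\<bar> * norm (h t) \<le> D * (C * exp (- t))"
        using D[of "exp (-t)"] t bound[OF t] by (intro mult_mono) auto
      then show "norm (\<phi> (exp (- t)) *\<^sub>R h t) \<le> D * C * exp (- 1 * t)" by simp
    qed auto
  qed
  have poly0: "integral {0..} (\<lambda>t. p (exp (- t)) *\<^sub>R h t) = 0" if p: "real_polynomial_function p" for p
  proof -
    obtain a n where p: "p = (\<lambda>x. \<Sum>i\<le>n. a i * x^i)"
      using p real_polynomial_function_iff_sum by blast
    have "integral {0..} (\<lambda>t. \<Sum>i\<le>n. a i *\<^sub>R (exp (- real i * t) *\<^sub>R h t))
        = (\<Sum>i\<le>n. integral {0..} (\<lambda>t. a i *\<^sub>R (exp (- real i * t) *\<^sub>R h t)))"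
    proof (rule integral_sum, simp, rule integrable_cmul)
      fix i
      have "exp (- t) ^ i = exp (- real i * t)" for t :: real
        by (simp add: exp_of_nat_mult[symmetric])
      then show "(\<lambda>t. exp (- real i * t) *\<^sub>R h t) integrable_on {0..}"
        using intw[of "\<lambda>x. x ^ i"] by (simp add: continuous_on_power)
    qed
    also have "\<dots> = (\<Sum>i\<le>n. a i *\<^sub>R integral {0..} (\<lambda>t. exp (- real i * t) *\<^sub>R h t))"
      by (simp only: integral_cmul)
    also have "\<dots> = 0" by (simp only: zero scaleR_zero_right sum.neutral_const)
    finally show ?thesis
      by (simp add: p scaleR_sum_left exp_of_nat_mult[symmetric])
  qed
  have cont0: "integral {0..} (\<lambda>t. \<phi> (exp (- t)) *\<^sub>R h t) = 0" if \<phi>: "continuous_on {0..1} \<phi>" for \<phi>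
  proof -
    have "norm (integral {0..} (\<lambda>t. \<phi> (exp (- t)) *\<^sub>R h t)) \<le> 0 + e" if e: "e > 0" for e
    proof -
      \<comment> \<open>\<open>C + 1\<close> replaces \<open>C\<close> because \<open>C\<close> may
        be 0; the final bound \<open>e / (C + 1) * C\<close> is still at most
        \<open>e\<close>.\<close>
      have e': "e / (C + 1) > 0" using C0 e by simp
      obtain p where p: "real_polynomial_function p" "\<And>x. x \<in> {0..1} \<Longrightarrow> \<bar>\<phi> x - p x\<bar> < e / (C + 1)"
        using Stone_Weierstrass_real_polynomial_function[OF compact_Icc \<phi> e'] by blast
      have pc: "continuous_on {0..1} p"
        using p(1) continuous_on_polymonial_function real_polynomial_function_eq by blast
      have "integral {0..} (\<lambda>t. \<phi> (exp (- t)) *\<^sub>R h t) =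
          integral {0..} (\<lambda>t. \<phi> (exp (- t)) *\<^sub>R h t) - integral {0..} (\<lambda>t. p (exp (- t)) *\<^sub>R h t)"
        using poly0[OF p(1)] by simp
      also have "\<dots> = integral {0..} (\<lambda>t. \<phi> (exp (- t)) *\<^sub>R h t - p (exp (- t)) *\<^sub>R h t)"
        by (rule Henstock_Kurzweil_Integration.integral_diff[symmetric]) (intro intw \<phi> pc)+
      also have "norm \<dots> \<le> integral {0..} (\<lambda>t. e / (C + 1) * C * exp (- t))"
      proof (intro integral_norm_bound_integral integrable_diff intw \<phi> pc expint(1))
        fix t :: real assume "t \<in> {0..}"
        then have t: "t \<ge> 0" by simp
        have "\<bar>\<phi> (exp (- t)) - p (exp (- t))\<bar> * norm (h t) \<le> e / (C + 1) * (C * exp (- t))"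
          using p(2)[of "exp (- t)"] t bound[OF t] e' by (intro mult_mono) auto
        then show "norm (\<phi> (exp (- t)) *\<^sub>R h t - p (exp (- t)) *\<^sub>R h t) \<le> e / (C + 1) * C * exp (- t)"
          by (simp flip: scaleR_diff_left)
      qed
      also have "\<dots> = e / (C + 1) * C" by (rule expint(2))
      also have "\<dots> \<le> e" using C0 e by (simp add: field_simps)
      finally show ?thesis by simp
    qed
    then have "norm (integral {0..} (\<lambda>t. \<phi> (exp (- t)) *\<^sub>R h t)) \<le> 0" by (rule field_le_epsilon)
    then show ?thesis by simp
  qed
  show ?thesis
  proof (rule ccontr)
    assume nz: "h t \<noteq> 0"
    define e where "e = norm (h t) / 2"
    have e: "e > 0" using nz by (simp add: e_def)
    obtain d where d: "d > 0" "\<And>s. s \<ge> 0 \<Longrightarrow> \<bar>s - t\<bar> < d \<Longrightarrow> norm (h s - h t) < e"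
      using cont t e unfolding continuous_on_iff by (force simp: dist_norm)
    define x where "x = exp (- t)"
    \<comment> \<open>Continuity of \<open>ln\<close> at \<open>x\<close> turns closeness of
      \<open>exp (- s)\<close> to \<open>x\<close> into closeness of \<open>s\<close> to
      \<open>t\<close>.\<close>
    obtain r where r: "r > 0" "\<And>s. \<bar>exp (- s) - x\<bar> < r \<Longrightarrow> \<bar>s - t\<bar> < d"
    proof -
      have "isCont ln x" by (intro continuous_intros) (simp_all add: x_def)
      then obtain r where r: "r > 0" "\<And>z. \<bar>z - x\<bar> < r \<Longrightarrow> \<bar>ln z - ln x\<bar> < d"
        using d(1) unfolding continuous_at_eps_delta by (auto simp: dist_norm)
      show thesis
      proof (rule that[OF r(1)])
        fix s assume "\<bar>exp (- s) - x\<bar> < r"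
        from r(2)[OF this] show "\<bar>s - t\<bar> < d" by (simp add: x_def)
      qed
    qed
    define \<phi> where "\<phi> z = max 0 (r - \<bar>z - x\<bar>)" for z
    have \<phi>c: "continuous_on S \<phi>" for S unfolding \<phi>_def by (intro continuous_intros)
    have \<phi>nn: "\<phi> z \<ge> 0" for z by (simp add: \<phi>_def)
    \<comment> \<open>The bump alone need not vanish as \<open>exp (- s)\<close> tends to 0; the
      factor \<open>exp (- s)\<close> makes the weight integrable on the half-line.\<close>
    define k where "k s = \<phi> (exp (- s)) * exp (- s)" for s
    have kc: "continuous_on S k" for S unfolding k_def
      by (intro continuous_intros continuous_on_compose2[OF \<phi>c[of UNIV]]) auto
    have kint: "k integrable_on {0..}"
    proof (rule integrable_on_atLeast_exp_bounded[OF kc, of 1 _ r])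
      show "norm (k s) \<le> r * exp (- 1 * s)" for s
        using r(1) by (auto simp: k_def \<phi>_def abs_mult mult_right_mono)
    qed auto
    have "integral {0..} (\<lambda>s. k s *\<^sub>R h s) = 0"
      using cont0[of "\<lambda>z. \<phi> z * z"] by (simp add: k_def continuous_on_mult \<phi>c)
    moreover have khint: "(\<lambda>s. k s *\<^sub>R h s) integrable_on {0..}"
      using intw[of "\<lambda>z. \<phi> z * z"] by (simp add: k_def continuous_on_mult \<phi>c)
    moreover have kh: "((\<lambda>s. k s *\<^sub>R h t) has_integral integral {0..} k *\<^sub>R h t) {0..}"
      using has_integral_linear[OF integrable_integral[OF kint] bounded_linear_scaleR_left[of "h t"]]
      by (simp add: o_def)
    ultimately have "((\<lambda>s. k s *\<^sub>R h t - k s *\<^sub>R h s) has_integral (integral {0..} k *\<^sub>R h t - 0)) {0..}"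
      by (intro has_integral_diff) (auto simp: has_integral_iff)
    then have "norm (integral {0..} k *\<^sub>R h t) = norm (integral {0..} (\<lambda>s. k s *\<^sub>R h t - k s *\<^sub>R h s))"
      by (simp add: integral_unique)
    \<comment> \<open>Where the weight is nonzero, \<open>h s\<close> is within \<open>e\<close> of
      \<open>h t\<close>; elsewhere both sides vanish. As \<open>e\<close> is half of
      \<open>norm (h t)\<close>, this contradicts positivity of the integral of
      \<open>k\<close>.\<close>
    also have "\<dots> \<le> integral {0..} (\<lambda>s. e * k s)"
    proof (intro integral_norm_bound_integral integrable_diff khint integrable_on_mult_right kint)
      show "(\<lambda>s. k s *\<^sub>R h t) integrable_on {0..}" using kh by blast
      fix s :: real assume s: "s \<in> {0..}"
      have knn: "k s \<ge> 0" by (simp add: k_def \<phi>nn)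
      show "norm (k s *\<^sub>R h t - k s *\<^sub>R h s) \<le> e * k s"
      proof (cases "\<bar>exp (- s) - x\<bar> < r")
        case True
        then have "norm (h t - h s) \<le> e" using d(2)[of s] r(2)[of s] s by (auto simp: norm_minus_commute)
        then have "k s * norm (h t - h s) \<le> k s * e" using knn by (rule mult_left_mono)
        then show ?thesis using knn by (simp add: mult.commute flip: scaleR_diff_right)
      next
        case False
        then show ?thesis by (simp add: k_def \<phi>_def)
      qed
    qed
    also have "\<dots> = e * integral {0..} k" by simp
    finally have le: "\<bar>integral {0..} k\<bar> * norm (h t) \<le> e * integral {0..} k" by simp
    \<comment> \<open>The continuous nonnegative weight is positive at \<open>t\<close>, so already
      its integral over \<open>{t..t+1}\<close> is positive.\<close>
    have "integral {0..} k > 0"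
    proof -
      have "\<not> (\<forall>s\<in>{t..t+1}. k s = 0)"
        using r(1) by (auto simp: k_def \<phi>_def x_def intro!: bexI[of _ t])
      moreover have "integral {t..t+1} k \<ge> 0"
        by (rule integral_nonneg) (auto simp: k_def \<phi>nn intro!: integrable_continuous_interval kc[unfolded k_def])
      ultimately have "integral {t..t+1} k > 0"
        using integral_eq_0_iff[of t "t+1" k] kc by (force simp: k_def \<phi>nn)
      also have "\<dots> \<le> integral {0..} k"
        by (rule integral_subset_le)
          (use t kint in \<open>auto simp: k_def \<phi>nn intro!: integrable_continuous_interval kc[unfolded k_def]\<close>)
      finally show ?thesis .
    qed
    with le e show False by (simp add: e_def)
  qed
qed

section \<open>The Laplace transform and groups\<close>

interpretation scaleC: vector_space "scaleC :: complex \<Rightarrow> 'a \<Rightarrow> 'a :: complex_normed_vector"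
  by (rule vector_space_scaleC)

lemma scaleR_scaleC_eq: "r *\<^sub>R (x :: 'a::complex_normed_vector) = complex_of_real r *\<^sub>C x"
  by (simp add: scaleC_of_real)

lemma bounded_bilinear_scaleC:
  "bounded_bilinear (scaleC :: complex \<Rightarrow> 'a \<Rightarrow> 'a::complex_normed_vector)"
proof
  show "\<exists>K. \<forall>c (x::'a). norm (c *\<^sub>C x) \<le> norm c * norm x * K"
    by (intro exI[of _ 1]) (simp add: norm_scaleC)
qed (simp_all add: scaleC_add_left scaleC_add_right scaleR_scaleC_eq scaleC_scaleC scaleR_conv_of_real mult.commute)

lemmas bounded_linear_scaleC_right = bounded_bilinear.bounded_linear_right[OF bounded_bilinear_scaleC]

text \<open>The lower limit is arbitrary because differentiating the tail integral at 0 involves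
  negative lower limits.\<close>

lemma laplace_integrable:
  fixes f :: "real \<Rightarrow> 'a::complex_banach"
  assumes cont: "continuous_on {c..} f" and bound: "\<And>t. t \<ge> c \<Longrightarrow> norm (f t) \<le> C * exp (w * t)" and l: "Re l > w"
  shows "(\<lambda>t. exp (- l * complex_of_real t) *\<^sub>C f t) integrable_on {c..}"
proof (rule integrable_on_atLeast_exp_bounded[of _ _ "Re l - w" C])
  show "continuous_on {c..} (\<lambda>t. exp (- l * complex_of_real t) *\<^sub>C f t)"
    by (intro bounded_bilinear.continuous_on[OF bounded_bilinear_scaleC] continuous_intros cont)
  fix t assume "t \<ge> c"
  from bound[OF this] have "exp (- (Re l * t)) * norm (f t) \<le> exp (- (Re l * t)) * (C * exp (w * t))"
    by (rule mult_left_mono) simp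
  then show "norm (exp (- l * complex_of_real t) *\<^sub>C f t) \<le> C * exp (- (Re l - w) * t)"
    by (simp add: norm_scaleC mult.left_commute algebra_simps flip: exp_add)
qed (use l in simp)

lemma laplace_bounded_clinear:
  fixes f :: "real \<Rightarrow> 'a::complex_banach" and F :: "'a \<Rightarrow> 'b::complex_banach"
  assumes "continuous_on {0..} f" and "\<And>t. t \<ge> 0 \<Longrightarrow> norm (f t) \<le> C * exp (w * t)" and "Re l > w"
    and F: "bounded_clinear F"
  shows "laplace (\<lambda>t. F (f t)) l = F (laplace f l)"
proof -
  have "bounded_linear F" "\<And>c x. F (c *\<^sub>C x) = c *\<^sub>C F x" using F by (auto simp: bounded_clinear_def)
  then show ?thesis
    using integral_linear[OF laplace_integrable[OF assms(1-3)], of F]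
    by (simp add: laplace_def o_def)
qed

lemma laplace_add:
  fixes f g :: "real \<Rightarrow> 'a::complex_banach"
  assumes f: "continuous_on {0..} f" "\<And>t. t \<ge> 0 \<Longrightarrow> norm (f t) \<le> C * exp (w * t)"
    and g: "continuous_on {0..} g" "\<And>t. t \<ge> 0 \<Longrightarrow> norm (g t) \<le> D * exp (w * t)"
    and l: "Re l > w"
  shows "laplace (\<lambda>t. f t + g t) l = laplace f l + laplace g l"
  unfolding laplace_def scaleC_add_right
  by (rule Henstock_Kurzweil_Integration.integral_add[OF laplace_integrable[OF f l] laplace_integrable[OF g l]])

text \<open>Damping the difference by \<open>exp (- (w + 1) * t)\<close> makes it decay like
  \<open>exp (- t)\<close>; the transforms at the real points \<open>w + 1 + n\<close> are then
  exactly its exponential moments.\<close>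

lemma laplace_injective:
  fixes f g :: "real \<Rightarrow> 'a::complex_banach"
  assumes f: "continuous_on {0..} f" "\<And>t. t \<ge> 0 \<Longrightarrow> norm (f t) \<le> C * exp (w * t)"
    and g: "continuous_on {0..} g" "\<And>t. t \<ge> 0 \<Longrightarrow> norm (g t) \<le> D * exp (w * t)"
    and eq: "\<And>s. s > w \<Longrightarrow> laplace f (complex_of_real s) = laplace g (complex_of_real s)"
    and t: "t \<ge> 0"
  shows "f t = g t"
proof -
  define h where "h t = exp (- (w + 1) * t) *\<^sub>R (f t - g t)" for t
  have "h t = 0"
  proof (rule integral_exp_moments_eq_zero[OF _ _ _ t])
    show "continuous_on {0..} h" unfolding h_def by (intro continuous_intros f g)
    fix t :: real assume t: "t \<ge> 0"
    have "norm (f t - g t) \<le> (C + D) * exp (w * t)"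
      using norm_triangle_ineq4[of "f t" "g t"] f(2)[OF t] g(2)[OF t] by (simp add: distrib_right)
    then have "exp (- (w + 1) * t) * norm (f t - g t) \<le> exp (- (w + 1) * t) * ((C + D) * exp (w * t))"
      by (rule mult_left_mono) simp
    also have "\<dots> = (C + D) * (exp (- (w + 1) * t) * exp (w * t))" by simp
    also have "exp (- (w + 1) * t) * exp (w * t) = exp (- t)"
      by (simp add: algebra_simps flip: exp_add)
    finally show "norm (h t) \<le> (C + D) * exp (- t)"
      by (simp add: h_def)
  next
    fix n :: nat
    define s where "s = w + 1 + real n"
    have s: "s > w" by (simp add: s_def)
    then have s': "Re (complex_of_real s) > w" by simp
    have "0 = laplace f s - laplace g s" using eq[OF s] by simp
    also have "\<dots> = integral {0..} (\<lambda>t. exp (- complex_of_real s * complex_of_real t) *\<^sub>C f t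
        - exp (- complex_of_real s * complex_of_real t) *\<^sub>C g t)"
      unfolding laplace_def
      by (rule Henstock_Kurzweil_Integration.integral_diff
          [OF laplace_integrable[OF f s'] laplace_integrable[OF g s'], symmetric])
    also have "(\<lambda>t. exp (- complex_of_real s * complex_of_real t) *\<^sub>C f t
        - exp (- complex_of_real s * complex_of_real t) *\<^sub>C g t) = (\<lambda>t. exp (- real n * t) *\<^sub>R h t)"
    proof
      fix t :: real
      have "exp (- complex_of_real s * complex_of_real t) = complex_of_real (exp (- s * t))"
        by (simp flip: exp_of_real)
      moreover have "exp (- s * t) = exp (- real n * t) * exp (- (w + 1) * t)"
        by (simp add: s_def algebra_simps flip: exp_add)
      ultimately have "exp (- complex_of_real s * complex_of_real t)
          = complex_of_real (exp (- real n * t) * exp (- (w + 1) * t))" by (simp only:)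
      then show "exp (- complex_of_real s * complex_of_real t) *\<^sub>C f t
        - exp (- complex_of_real s * complex_of_real t) *\<^sub>C g t = exp (- real n * t) *\<^sub>R h t"
        by (simp only: scaleC_of_real h_def scaleR_diff_right scaleR_scaleR)
    qed
    finally show "integral {0..} (\<lambda>t. exp (- real n * t) *\<^sub>R h t) = 0" by simp
  qed
  then show ?thesis by (simp add: h_def)
qed

lemma scaleC_exp_has_vector_derivative:
  fixes F :: "real \<Rightarrow> 'a::complex_normed_vector"
  assumes "(F has_vector_derivative D) (at 0)"
  shows "((\<lambda>h. exp (l * complex_of_real h) *\<^sub>C F h) has_vector_derivative l *\<^sub>C F 0 + D) (at 0)"
proof -
  have "((\<lambda>h. exp (l * complex_of_real h)) has_vector_derivative l) (at 0)"
  proof -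
    have "((\<lambda>z. exp (l * z)) has_field_derivative l) (at (complex_of_real 0))"
      by (auto intro!: derivative_eq_intros)
    from has_vector_derivative_real_field[OF this] show ?thesis by (simp add: o_def)
  qed
  from bounded_bilinear.has_vector_derivative[OF bounded_bilinear_scaleC this assms]
  show ?thesis by (simp add: add.commute)
qed

text \<open>This connects the difference quotient in the definition of a generator with the calculus
  of derivatives.\<close>

lemma orbit_derivative_at_0:
  fixes S :: "real \<Rightarrow> 'a::real_normed_vector \<Rightarrow> 'a"
  assumes "S 0 z = z"
  shows "((\<lambda>h. (S h z - z) /\<^sub>R h) \<longlongrightarrow> w) (at 0) \<longleftrightarrow> ((\<lambda>h. S h z) has_vector_derivative w) (at 0)"
proof -
  have "((\<lambda>h. S h z) has_vector_derivative w) (at 0)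
      \<longleftrightarrow> ((\<lambda>h. norm (S h z - z - h *\<^sub>R w) / norm h) \<longlongrightarrow> 0) (at 0)"
    by (simp add: has_vector_derivative_def has_derivative_at bounded_linear_scaleR_left assms)
  also have "\<dots> \<longleftrightarrow> ((\<lambda>h. norm ((S h z - z) /\<^sub>R h - w)) \<longlongrightarrow> 0) (at 0)"
  proof (rule tendsto_cong)
    have "norm (S h z - z - h *\<^sub>R w) / norm h = norm ((S h z - z) /\<^sub>R h - w)" if "h \<noteq> 0" for h
    proof -
      have "(S h z - z) /\<^sub>R h - w = (S h z - z - h *\<^sub>R w) /\<^sub>R h"
        using that by (simp add: scaleR_diff_right)
      then show ?thesis by (simp add: divide_inverse mult.commute)
    qed
    then show "\<forall>\<^sub>F h in at 0. norm (S h z - z - h *\<^sub>R w) / norm h = norm ((S h z - z) /\<^sub>R h - w)"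
      by (auto simp: eventually_at_filter)
  qed
  also have "\<dots> \<longleftrightarrow> ((\<lambda>h. (S h z - z) /\<^sub>R h) \<longlongrightarrow> w) (at 0)"
    by (simp add: tendsto_norm_zero_iff LIM_zero_iff)
  finally show ?thesis by simp
qed

section \<open>Exponentially bounded groups: resolvent equation and eigenvectors\<close>

locale exp_bounded_C0_group =
  fixes S :: "real \<Rightarrow> 'a::complex_banach \<Rightarrow> 'a" and M w :: real
  assumes group: "C0_group S"
    and growth: "\<And>t z. norm (S t z) \<le> M * exp (w * \<bar>t\<bar>) * norm z"
    and w_nonneg: "w \<ge> 0" and M_ge: "M \<ge> 1"
begin

lemma orbit_clinear: "bounded_clinear (S t)"
  and zero: "S 0 z = z"
  and add: "S (s + t) z = S s (S t z)"
  and orbit_continuous: "continuous_on A (\<lambda>t. S t z)"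
  using group by (auto simp: C0_group_def intro: continuous_on_subset)

text \<open>To the right of \<open>c\<close>, \<bar>t\<bar> is at most 2\<bar>c\<bar> + t, so the
  two-sided bound becomes one in \<open>exp (w * t)\<close> at the cost of a constant; this admits
  Laplace integrals with negative lower limit.\<close>

lemma growth_atLeast:
  assumes "t \<ge> c"
  shows "norm (S t z) \<le> (M * norm z * exp (2 * w * \<bar>c\<bar>)) * exp (w * t)"
proof -
  have "\<bar>t\<bar> \<le> 2 * \<bar>c\<bar> + t" using assms by auto
  then have "w * \<bar>t\<bar> \<le> w * (2 * \<bar>c\<bar> + t)" using w_nonneg by (rule mult_left_mono)
  then have "exp (w * \<bar>t\<bar>) \<le> exp (2 * w * \<bar>c\<bar>) * exp (w * t)"
    by (simp add: algebra_simps flip: exp_add)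
  then have "M * norm z * exp (w * \<bar>t\<bar>) \<le> M * norm z * (exp (2 * w * \<bar>c\<bar>) * exp (w * t))"
    using M_ge by (intro mult_left_mono) auto
  then show ?thesis using growth[of t z] by (simp add: mult_ac)
qed

lemma growth_nonneg: "t \<ge> 0 \<Longrightarrow> norm (S t z) \<le> (M * norm z) * exp (w * t)"
  using growth[of t z] by (simp add: mult_ac)

lemma clinear_image_growth:
  fixes F :: "'a \<Rightarrow> 'b::complex_banach"
  assumes "bounded_clinear F"
  obtains C where "continuous_on UNIV (\<lambda>t. F (S t z))" "\<And>t. norm (F (S t z)) \<le> C * exp (w * \<bar>t\<bar>)"
proof -
  have F: "bounded_linear F" using assms by (simp add: bounded_clinear_def)
  obtain K where K: "K \<ge> 0" "\<And>p. norm (F p) \<le> norm p * K" using bounded_linear.nonneg_bounded[OF F] by blast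
  show thesis
  proof (rule that[of "M * norm z * K"])
    show "continuous_on UNIV (\<lambda>t. F (S t z))"
      by (rule bounded_linear.continuous_on[OF F orbit_continuous])
    fix t
    have "norm (F (S t z)) \<le> M * exp (w * \<bar>t\<bar>) * norm z * K"
      using K(2)[of "S t z"] mult_right_mono[OF growth[of t z] K(1)] by (rule order_trans)
    then show "norm (F (S t z)) \<le> M * norm z * K * exp (w * \<bar>t\<bar>)" by (simp add: mult_ac)
  qed
qed

lemma orbit_laplace_integrable:
  assumes "Re l > w"
  shows "(\<lambda>t. exp (- l * complex_of_real t) *\<^sub>C S t z) integrable_on {c..}"
  by (rule laplace_integrable[OF orbit_continuous growth_atLeast assms])

text \<open>The Laplace transform of an orbit solves the resolvent equation: shifting the orbit by \<open>h\<close>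
  moves the lower limit of the integral, so \<open>S h\<close> of it is \<open>exp (l * h)\<close> times a tail integral.\<close>

lemma laplace_orbit_derivative:
  assumes l: "Re l > w"
  shows "((\<lambda>h. S h (laplace (\<lambda>t. S t z) l)) has_vector_derivative l *\<^sub>C laplace (\<lambda>t. S t z) l - z) (at 0)"
proof -
  define g where "g t = exp (- l * complex_of_real t) *\<^sub>C S t z" for t
  have gc: "continuous_on UNIV g" unfolding g_def
    by (intro bounded_bilinear.continuous_on[OF bounded_bilinear_scaleC] continuous_intros orbit_continuous)
  have gi: "g integrable_on {c..}" for c
    unfolding g_def by (rule orbit_laplace_integrable[OF l])
  have v: "laplace (\<lambda>t. S t z) l = integral {0..} g" by (simp only: laplace_def g_def[abs_def])
  have "S h (integral {0..} g) = exp (l * complex_of_real h) *\<^sub>C integral {h..} g" for h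
  proof -
    have "(g has_integral integral {h..} g) {h..}" using gi by (rule integrable_integral)
    from has_integral_shift_atLeast[OF this]
    have "((\<lambda>t. exp (l * complex_of_real h) *\<^sub>C g (t + h)) has_integral
        exp (l * complex_of_real h) *\<^sub>C integral {h..} g) {0..}"
      by (rule has_integral_linear[OF _ bounded_linear_scaleC_right, unfolded o_def])
    moreover have "exp (l * complex_of_real h) *\<^sub>C g (t + h) = S h (g t)" for t
    proof -
      have "exp (l * complex_of_real h) * exp (- l * complex_of_real (t + h)) = exp (- l * complex_of_real t)"
        by (simp add: algebra_simps flip: exp_add)
      moreover have "S (t + h) z = S h (S t z)" using add[of h t z] by (simp add: add.commute)
      ultimately show ?thesis
        using orbit_clinear[of h] by (simp add: g_def scaleC_scaleC bounded_clinear_def)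
    qed
    moreover have "((\<lambda>t. S h (g t)) has_integral S h (integral {0..} g)) {0..}"
      using has_integral_linear[OF integrable_integral[OF gi[of 0]], of "S h"] orbit_clinear[of h]
      by (simp add: o_def bounded_clinear_def)
    ultimately show ?thesis by (simp add: has_integral_unique)
  qed
  moreover have "((\<lambda>h. exp (l * complex_of_real h) *\<^sub>C integral {h..} g) has_vector_derivative
      l *\<^sub>C integral {0..} g + - g 0) (at 0)"
    by (rule scaleC_exp_has_vector_derivative[OF integral_atLeast_has_vector_derivative[OF gc gi]])
  ultimately show ?thesis
    using scaleC.scale_one[of z] by (simp add: v g_def zero)
qed

text \<open>The function \<open>exp (- l * t) *\<^sub>C S t z\<close> has derivative 0 and therefore
  always equals \<open>z\<close>, while the growth bound makes it tend to 0 as \<open>t\<close>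
  grows.\<close>

lemma eigenvector_zero:
  assumes l: "Re l > w" and z: "((\<lambda>h. S h z) has_vector_derivative l *\<^sub>C z) (at 0)"
  shows "z = 0"
proof -
  define W where "W t = exp (- l * complex_of_real t) *\<^sub>C S t z" for t
  have "(W has_vector_derivative 0) (at t)" for t
  proof -
    have "((\<lambda>h. exp (- l * complex_of_real h) *\<^sub>C S h z) has_vector_derivative (- l) *\<^sub>C S 0 z + l *\<^sub>C z) (at 0)"
      by (rule scaleC_exp_has_vector_derivative[OF z])
    then have "((\<lambda>h. W h) has_vector_derivative 0) (at 0)"
      by (simp add: zero W_def)
    \<comment> \<open>This bounded map sends \<open>W h\<close> to \<open>W (t + h)\<close>, so the
      derivative of \<open>W\<close> at 0 carries over to every \<open>t\<close>.\<close>
    moreover have "bounded_linear (\<lambda>y. exp (- l * complex_of_real t) *\<^sub>C S t y)"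
      using orbit_clinear[of t]
      by (auto simp: bounded_clinear_def intro: bounded_linear_compose[OF bounded_linear_scaleC_right])
    ultimately have "((\<lambda>h. exp (- l * complex_of_real t) *\<^sub>C S t (W h)) has_vector_derivative
        exp (- l * complex_of_real t) *\<^sub>C S t 0) (at 0)"
      by (rule bounded_linear.has_vector_derivative[rotated])
    moreover have "exp (- l * complex_of_real t) *\<^sub>C S t (W h) = W (t + h)" for h
    proof -
      have "exp (- l * complex_of_real t) * exp (- l * complex_of_real h) = exp (- l * complex_of_real (t + h))"
        by (simp add: algebra_simps flip: exp_add)
      then show ?thesis
        using orbit_clinear[of t] by (simp add: W_def bounded_clinear_def scaleC_scaleC add)
    qed
    moreover have "S t 0 = 0" using orbit_clinear[of t] linear_0 bounded_linear.linear
      by (auto simp: bounded_clinear_def)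
    ultimately have "((\<lambda>h. W (t + h)) has_vector_derivative 0) (at 0)" by simp
    then show "(W has_vector_derivative 0) (at t)"
      unfolding has_vector_derivative_def has_derivative_at by simp
  qed
  then have "(W has_derivative (\<lambda>h. 0)) (at t)" for t
    by (simp add: has_vector_derivative_def)
  then have "\<exists>c. \<forall>t\<in>UNIV. W t = c"
    by (intro has_derivative_zero_constant[OF convex_UNIV])
  then obtain c where c: "\<And>t. W t = c" by blast
  have "W 0 = z" using zero[of z] scaleC.scale_one[of z] by (simp add: W_def)
  then have W: "W t = z" for t using c[of t] c[of 0] by simp
  have "norm z \<le> M * norm z * exp ((w - Re l) * t)" if "t \<ge> 0" for t
  proof -
    have "norm z = exp (- (Re l * t)) * norm (S t z)"
      using arg_cong[OF W[of t], of norm] by (simp add: W_def norm_scaleC)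
    also have "\<dots> \<le> exp (- (Re l * t)) * (M * norm z * exp (w * t))"
      by (rule mult_left_mono[OF growth_nonneg[OF that]]) simp
    also have "\<dots> = M * norm z * exp ((w - Re l) * t)"
      by (simp add: algebra_simps exp_diff exp_minus divide_inverse)
    finally show ?thesis .
  qed
  then have "\<forall>\<^sub>F t in at_top. norm z \<le> M * norm z * exp ((w - Re l) * t)"
    by (auto simp: eventually_at_top_linorder)
  moreover have "((\<lambda>t. M * norm z * exp ((w - Re l) * t)) \<longlongrightarrow> M * norm z * 0) at_top"
  proof (intro tendsto_intros filterlim_compose[OF exp_at_bot])
    show "LIM t at_top. (w - Re l) * t :> at_bot"
      using l by (intro filterlim_tendsto_neg_mult_at_bot[OF tendsto_const]) (auto simp: filterlim_ident)
  qed
  ultimately have "norm z \<le> M * norm z * 0"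
    by (intro tendsto_lowerbound) auto
  then show ?thesis by simp
qed

end

text \<open>The growth bound is even in \<open>t\<close>, so both constants survive reversal.
  Reversal negates the generator, which is how the conditions at \<open>- l\<close> are
  reached.\<close>

lemma exp_bounded_C0_group_reverse:
  assumes "exp_bounded_C0_group S M w"
  shows "exp_bounded_C0_group (\<lambda>t. S (- t)) M w"
proof -
  interpret exp_bounded_C0_group S M w by fact
  have "continuous_on UNIV (\<lambda>t. S (- t) z)" for z
    by (rule continuous_on_compose2[OF orbit_continuous[of UNIV z]]) (auto intro: continuous_intros)
  moreover have "S (- (s + t)) = S (- s) \<circ> S (- t)" for s t
    using add[of "- s" "- t"] by (auto simp: algebra_simps)
  ultimately show ?thesis
    using group growth[of "- t" for t] w_nonneg M_ge
    by unfold_locales (auto simp: C0_group_def)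
qed

section \<open>The block operator and the quadratic pencil\<close>

lemma has_vector_derivative_reflect_0:
  assumes "((\<lambda>h. f (- h)) has_vector_derivative D) (at (0::real))"
  shows "(f has_vector_derivative - D) (at 0)"
proof -
  have "(uminus has_vector_derivative - 1) (at (0::real))"
    by (auto intro!: derivative_eq_intros)
  from vector_diff_chain_at[OF this, of "\<lambda>h. f (- h)" D] assms show ?thesis
    by (simp add: o_def)
qed

section \<open>Functions of exponential growth on both half-lines\<close>

lemma growth_space_bound:
  assumes "f \<in> growth_space \<nu>" "\<nu> \<le> w"
  obtains C where "\<And>t. norm (f t) \<le> C * exp (w * \<bar>t\<bar>)"
proof -
  obtain C where C: "\<And>t. exp (- \<nu> * \<bar>t\<bar>) * norm (f t) \<le> C"
    using assms(1) by (auto simp: growth_space_def bdd_above_def)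
  have C0: "C \<ge> 0" using C[of 0] norm_ge_zero[of "f 0"] by (simp del: norm_ge_zero)
  show thesis
  proof (rule that)
    fix t
    have "norm (f t) = exp (\<nu> * \<bar>t\<bar>) * (exp (- \<nu> * \<bar>t\<bar>) * norm (f t))"
      by (simp add: exp_minus)
    also have "\<dots> \<le> exp (\<nu> * \<bar>t\<bar>) * C" by (rule mult_left_mono[OF C]) simp
    also have "\<dots> \<le> exp (w * \<bar>t\<bar>) * C" using assms(2) C0 by (simp add: mult_right_mono)
    finally show "norm (f t) \<le> C * exp (w * \<bar>t\<bar>)" by (simp add: mult.commute)
  qed
qed

lemma growth_space_laplace_eqD:
  fixes f g :: "real \<Rightarrow> 'a::complex_banach"
  assumes f: "f \<in> growth_space \<nu>" and g: "g \<in> growth_space \<mu>" and w: "\<nu> \<le> w" "\<mu> \<le> w"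
    and eq: "\<And>s. s > w \<Longrightarrow> laplace f (complex_of_real s) = laplace g (complex_of_real s)"
    and t: "t \<ge> 0"
  shows "f t = g t"
proof -
  obtain C where C: "\<And>t. norm (f t) \<le> C * exp (w * \<bar>t\<bar>)" using growth_space_bound[OF f w(1)] by blast
  obtain D where D: "\<And>t. norm (g t) \<le> D * exp (w * \<bar>t\<bar>)" using growth_space_bound[OF g w(2)] by blast
  show ?thesis
  proof (rule laplace_injective[OF _ _ _ _ eq t])
    show "norm (f t) \<le> C * exp (w * t)" if "t \<ge> 0" for t using C[of t] that by simp
    show "norm (g t) \<le> D * exp (w * t)" if "t \<ge> 0" for t using D[of t] that by simp
  qed (use f g in \<open>auto simp: growth_space_def intro: continuous_on_subset\<close>)
qed

lemma growth_space_reflect: "f \<in> growth_space \<nu> \<Longrightarrow> (\<lambda>t. f (- t)) \<in> growth_space \<nu>"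
proof -
  assume f: "f \<in> growth_space \<nu>"
  then have c: "continuous_on UNIV f" by (simp add: growth_space_def)
  have "continuous_on UNIV (\<lambda>t. f (- t))"
    by (rule continuous_on_compose2[OF c]) (auto intro: continuous_intros)
  moreover have "range (\<lambda>t. exp (- \<nu> * \<bar>t\<bar>) * norm (f (- t))) \<subseteq> range (\<lambda>t. exp (- \<nu> * \<bar>t\<bar>) * norm (f t))"
  proof (intro image_subsetI)
    show "exp (- \<nu> * \<bar>t\<bar>) * norm (f (- t)) \<in> range (\<lambda>t. exp (- \<nu> * \<bar>t\<bar>) * norm (f t))" for t
      by (rule range_eqI[of _ _ "- t"]) simp
  qed
  ultimately show ?thesis
    using f by (auto simp: growth_space_def intro: bdd_above_mono)
qed

section \<open>The generator on \<open>Y \<times> X\<close> and the kernel of the pencil\<close>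

locale block_generator =
  fixes domA domB :: "'x::complex_banach set"
    and A B :: "'x \<Rightarrow> 'x"
    and j :: "'y::complex_banach \<Rightarrow> 'x"
    and T :: "real \<Rightarrow> 'y \<times> 'x \<Rightarrow> 'y \<times> 'x"
    and M w :: real
  assumes A: "linear_operator domA A"
    and B: "closed_operator domB B"
    and j: "continuous_embedding j"
    and domA: "domA \<subseteq> {a \<in> domB. B a \<in> domB} \<inter> range j"
    and B_domA: "B ` domA \<subseteq> range j"
    and range_j: "range j \<subseteq> domB"
    and gen: "generates_C0_group (block_dom j domA) (block_op j A B) T"
    and bound: "exp_bounded_C0_group T M w"
begin

sublocale T: exp_bounded_C0_group T M w by (rule bound)

sublocale rev: exp_bounded_C0_group "\<lambda>t. T (- t)" M w
  by (rule exp_bounded_C0_group_reverse[OF bound])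

lemma j_clinear: "bounded_clinear j" and j_linear: "bounded_linear j"
  and j_scaleC: "j (c *\<^sub>C a) = c *\<^sub>C j a" and j_add: "j (a + b) = j a + j b"
  and j_diff: "j (a - b) = j a - j b" and j_0: "j 0 = 0"
proof -
  show "bounded_clinear j" "bounded_linear j" "j (c *\<^sub>C a) = c *\<^sub>C j a"
    using j by (auto simp: continuous_embedding_def bounded_clinear_def)
  then have "linear j" by (simp add: bounded_linear.linear)
  then show "j (a + b) = j a + j b" "j (a - b) = j a - j b" "j 0 = 0"
    by (simp_all add: linear_add linear_diff linear_0)
qed

lemma A_subspace: "scaleC.subspace domA"
  and A_add: "p \<in> domA \<Longrightarrow> q \<in> domA \<Longrightarrow> A (p + q) = A p + A q"
  and A_scaleC: "p \<in> domA \<Longrightarrow> A (c *\<^sub>C p) = c *\<^sub>C A p"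
  using A by (auto simp: linear_operator_def)

lemma B_subspace: "scaleC.subspace domB"
  and B_add: "p \<in> domB \<Longrightarrow> q \<in> domB \<Longrightarrow> B (p + q) = B p + B q"
  and B_scaleC: "p \<in> domB \<Longrightarrow> B (c *\<^sub>C p) = c *\<^sub>C B p"
  and B_closed: "closed ((\<lambda>x. (x, B x)) ` domB)"
  using B by (auto simp: linear_operator_def closed_operator_def)

lemma quad_pencil_add:
  assumes "p \<in> domA" "q \<in> domA"
  shows "quad_pencil A B l (p + q) = quad_pencil A B l p + quad_pencil A B l q"
  using assms domA by (simp add: quad_pencil_def A_add B_add subset_iff scaleC_add_right algebra_simps)

lemma quad_pencil_scaleC:
  assumes "p \<in> domA"
  shows "quad_pencil A B l (c *\<^sub>C p) = c *\<^sub>C quad_pencil A B l p"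
  using assms domA
  by (simp add: quad_pencil_def A_scaleC B_scaleC subset_iff scaleC_add_right scaleC.scale_right_diff_distrib
      scaleC_scaleC mult.commute)

text \<open>The graph of \<open>B\<close> after \<open>j\<close> is the preimage of the closed graph
  of \<open>B\<close> under the continuous map \<open>(a, c) \<mapsto> (j a, c)\<close>, so the
  closed graph theorem applies.\<close>

lemma B_j_clinear: "bounded_clinear (\<lambda>a. B (j a))"
proof -
  have dom: "j a \<in> domB" for a using range_j by blast
  have scale: "B (j (c *\<^sub>C a)) = c *\<^sub>C B (j a)" for c a by (simp add: j_scaleC B_scaleC dom)
  have "linear (\<lambda>a. B (j a))"
    by (rule linearI) (simp_all add: j_add B_add dom scaleR_scaleC_eq scale)
  moreover have "range (\<lambda>a. (a, B (j a))) = (\<lambda>(a, c). (j a, c)) -` ((\<lambda>x. (x, B x)) ` domB)"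
    using dom by auto
  moreover have "closed ((\<lambda>(a, c). (j a, c)) -` ((\<lambda>x. (x, B x)) ` domB))"
    unfolding case_prod_unfold
    by (intro continuous_closed_vimage B_closed continuous_intros bounded_linear.isCont[OF j_linear])
  ultimately show ?thesis
    using scale closed_graph_theorem[of "\<lambda>a. B (j a)"] by (simp only: bounded_clinear_def) blast
qed

lemma orbit_derivative:
  "((\<lambda>h. T h z) has_vector_derivative v) (at 0) \<longleftrightarrow> z \<in> block_dom j domA \<and> v = block_op j A B z"
  unfolding orbit_derivative_at_0[of T z v, OF T.zero, symmetric]
  using gen unfolding generates_C0_group_def by blast

text \<open>On the domain both \<open>B (j a)\<close> and \<open>b\<close> lie in
  \<open>range j\<close>, so the pull-back by \<open>inv j\<close> in the first component is
  genuine.\<close>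

lemma j_fst_block_op:
  assumes "(a, b) \<in> block_dom j domA"
  shows "j (fst (block_op j A B (a, b))) = - B (j a) + b"
proof -
  have "B (j a) \<in> range j" "b \<in> range j" using assms B_domA by (auto simp: block_dom_def)
  then obtain c d where "B (j a) = j c" "b = j d" by blast
  then have "- B (j a) + b = j (d - c)" by (simp add: j_diff)
  then show ?thesis by (simp add: block_op_def f_inv_into_f)
qed

text \<open>The hypothesis is the equation \<open>(l - G) v = (0, z)\<close>. Its first row
  expresses \<open>b\<close> through \<open>a\<close>; inserted into the second row, this makes the
  two terms \<open>B (B (j a))\<close> cancel and leaves the pencil.\<close>

lemma orbit_derivativeD:
  assumes "((\<lambda>h. T h v) has_vector_derivative l *\<^sub>C v - (0, z)) (at 0)"
  shows "j (fst v) \<in> domA" "snd v = l *\<^sub>C j (fst v) + B (j (fst v))" "quad_pencil A B l (j (fst v)) = z"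
proof -
  obtain a b where v: "v = (a, b)" by (cases v)
  from assms have dom: "(a, b) \<in> block_dom j domA" and eq: "l *\<^sub>C (a, b) - (0, z) = block_op j A B (a, b)"
    by (simp_all only: orbit_derivative v)
  then have ja: "j a \<in> domA" by (simp add: block_dom_def)
  with domA have ja': "j a \<in> domB" "B (j a) \<in> domB" by auto
  have "l *\<^sub>C a = fst (block_op j A B (a, b))" by (simp add: scaleC_prod_def flip: eq)
  then have "l *\<^sub>C j a = - B (j a) + b" using j_fst_block_op[OF dom] by (metis j_scaleC)
  then have b: "b = l *\<^sub>C j a + B (j a)" by simp
  have "l *\<^sub>C b - z = snd (block_op j A B (a, b))" by (simp add: scaleC_prod_def flip: eq)
  also have "\<dots> = A (j a) + B (B (j a)) - B b" by (simp add: block_op_def)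
  also have "B b = l *\<^sub>C B (j a) + B (B (j a))"
    using ja' B_subspace by (simp add: b B_add B_scaleC scaleC.subspace_scale)
  finally have "z = l *\<^sub>C b + l *\<^sub>C B (j a) - A (j a)" by (simp add: algebra_simps)
  also have "\<dots> = quad_pencil A B l (j a)"
    by (simp add: b quad_pencil_def scaleC_add_right scaleC_scaleC power2_eq_square
        scaleC_add_left[of l l, folded mult_2])
  finally show "quad_pencil A B l (j (fst v)) = z" by (simp add: v)
  show "j (fst v) \<in> domA" "snd v = l *\<^sub>C j (fst v) + B (j (fst v))" by (simp_all add: v ja b)
qed

text \<open>Here the elimination runs backwards: injectivity of \<open>j\<close> recovers the first
  row, and the vanishing pencil, solved for \<open>A (j a)\<close>, gives the second.\<close>

lemma quad_pencil_zero_imp_eigenvector: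
  assumes ja: "j a \<in> domA" and Q: "quad_pencil A B l (j a) = 0"
  defines "v \<equiv> (a, l *\<^sub>C j a + B (j a))"
  shows "((\<lambda>h. T h v) has_vector_derivative l *\<^sub>C v) (at 0)"
proof -
  from ja domA have ja': "j a \<in> domB" "B (j a) \<in> domB" by auto
  obtain c where c: "B (j a) = j c" using ja B_domA by blast
  have dom: "v \<in> block_dom j domA"
    \<comment> \<open>The second component of \<open>v\<close> is the image under \<open>j\<close>
      of \<open>l *\<^sub>C a + c\<close>, hence lies in \<open>range j\<close> as the domain
      requires.\<close>
    using ja by (auto simp: v_def block_dom_def c intro!: image_eqI[of _ _ "l *\<^sub>C a + c"] simp: j_add j_scaleC)
  have "j (fst (block_op j A B v)) = j (l *\<^sub>C a)"
    using j_fst_block_op dom by (simp add: v_def j_scaleC)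
  then have "fst (block_op j A B v) = l *\<^sub>C a"
    using j by (simp add: continuous_embedding_def inj_eq)
  moreover have "snd (block_op j A B v) = l *\<^sub>C (l *\<^sub>C j a + B (j a))"
  proof -
    have "B (l *\<^sub>C j a + B (j a)) = l *\<^sub>C B (j a) + B (B (j a))"
      using ja' B_subspace by (simp add: B_add B_scaleC scaleC.subspace_scale)
    moreover have "A (j a) = l *\<^sub>C l *\<^sub>C j a + l *\<^sub>C B (j a) + l *\<^sub>C B (j a)"
      using Q by (simp add: quad_pencil_def scaleC_scaleC power2_eq_square
          scaleC_add_left[of l l, folded mult_2] add.assoc)
    ultimately show ?thesis by (simp add: v_def block_op_def scaleC_add_right)
  qed
  ultimately have "block_op j A B v = l *\<^sub>C v" by (simp add: prod_eq_iff v_def scaleC_prod_def)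
  with dom show ?thesis by (simp add: orbit_derivative)
qed

text \<open>A kernel vector at \<open>l\<close> yields an eigenvector of the generator for
  \<open>l\<close>; one at \<open>- l\<close> yields an eigenvector for \<open>l\<close> of the
  reversed group. Both are excluded by the growth bound.\<close>

lemma quad_pencil_kernel:
  assumes l: "Re l > w" and d: "d \<in> domA" and Q: "quad_pencil A B l d = 0 \<or> quad_pencil A B (- l) d = 0"
  shows "d = 0"
proof -
  obtain a where a: "d = j a" using d domA by blast
  from Q have "a = 0"
  proof
    assume "quad_pencil A B l d = 0"
    from T.eigenvector_zero[OF l quad_pencil_zero_imp_eigenvector[OF d[unfolded a] this[unfolded a]]]
    show "a = 0" by (simp add: prod_eq_iff)
  next
    define v where "v = (a, (- l) *\<^sub>C j a + B (j a))"
    assume "quad_pencil A B (- l) d = 0"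
    then have "((\<lambda>h. T (- (- h)) v) has_vector_derivative (- l) *\<^sub>C v) (at 0)"
      using quad_pencil_zero_imp_eigenvector[of a "- l"] d by (simp add: a v_def)
    from has_vector_derivative_reflect_0[OF this[folded minus_minus]]
    have "((\<lambda>h. T (- h) v) has_vector_derivative l *\<^sub>C v) (at 0)" by simp
    from rev.eigenvector_zero[OF l this] show "a = 0" by (simp add: v_def prod_eq_iff)
  qed
  then show ?thesis by (simp add: a j_0)
qed

lemma quad_pencil_inj:
  assumes "Re l > w" "p \<in> domA" "q \<in> domA"
    and "quad_pencil A B l p = quad_pencil A B l q \<or> quad_pencil A B (- l) p = quad_pencil A B (- l) q"
  shows "p = q"
proof -
  have dom: "(-1) *\<^sub>C q \<in> domA" using A_subspace assms(3) scaleC.subspace_scale by blast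
  have "p + (-1) *\<^sub>C q \<in> domA" using A_subspace assms(2) dom scaleC.subspace_add by blast
  moreover have "quad_pencil A B m (p + (-1) *\<^sub>C q) = quad_pencil A B m p - quad_pencil A B m q" for m
    by (simp only: quad_pencil_add[OF assms(2) dom] quad_pencil_scaleC[OF assms(3)]) simp
  ultimately have "p + (-1) *\<^sub>C q = 0"
    using assms(4) by (intro quad_pencil_kernel[OF assms(1)]) auto
  then show ?thesis by simp
qed

text \<open>The resolvent equation is applied to both groups. For the reversed one, reflecting the
  derivative changes its sign, so that \<open>l\<close> becomes \<open>- l\<close> and
  \<open>z\<close> becomes \<open>- z\<close>.\<close>

lemma resolvent_orbit:
  fixes z :: 'x
  assumes l: "Re l > w"
  defines "v \<equiv> laplace (\<lambda>t. T t (0, z)) l" and "v' \<equiv> laplace (\<lambda>t. T (- t) (0, z)) l"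
  shows "j (fst v) \<in> domA" "snd v = l *\<^sub>C j (fst v) + B (j (fst v))"
    "quad_pencil A B l (j (fst v)) = z"
    "j (fst v') \<in> domA" "snd v' = (- l) *\<^sub>C j (fst v') + B (j (fst v'))"
    "quad_pencil A B (- l) (j (fst v')) = - z"
proof -
  have "((\<lambda>h. T h v) has_vector_derivative l *\<^sub>C v - (0, z)) (at 0)"
    unfolding v_def by (rule T.laplace_orbit_derivative[OF l])
  from orbit_derivativeD[OF this] show "j (fst v) \<in> domA" "snd v = l *\<^sub>C j (fst v) + B (j (fst v))"
    "quad_pencil A B l (j (fst v)) = z" .
  have "((\<lambda>h. T (- h) v') has_vector_derivative l *\<^sub>C v' - (0, z)) (at 0)"
    unfolding v'_def by (rule rev.laplace_orbit_derivative[OF l])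
  from has_vector_derivative_reflect_0[OF this]
  have "((\<lambda>h. T h v') has_vector_derivative (- l) *\<^sub>C v' - (0, - z)) (at 0)"
    by (simp add: prod_eq_iff scaleC_prod_def)
  from orbit_derivativeD[OF this] show "j (fst v') \<in> domA"
    "snd v' = (- l) *\<^sub>C j (fst v') + B (j (fst v'))" "quad_pencil A B (- l) (j (fst v')) = - z" .
qed

section \<open>Existence: the explicit formula and its Laplace transforms\<close>

definition "solution x z t = block22 T t x - B (j (block12 T t x)) + j (block12 T t z)"

text \<open>These two maps, applied to the orbits of \<open>(0, x)\<close> and
  \<open>(0, z)\<close>, add up to \<open>solution x z\<close>. Their boundedness gives the growth
  of the solution and the interchange with the Laplace integral.\<close>

lemma first_component_clinear: "bounded_clinear (\<lambda>p. snd p - B (j (fst p)))"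
  and second_component_clinear: "bounded_clinear (\<lambda>p :: 'y \<times> 'x. j (fst p))"
proof -
  have "bounded_linear (\<lambda>p. B (j (fst p)))" "bounded_linear (\<lambda>p :: 'y \<times> 'x. j (fst p))"
    using bounded_linear_compose[OF _ bounded_linear_fst] B_j_clinear j_clinear
    by (auto simp: bounded_clinear_def)
  moreover have "B (j (c *\<^sub>C a)) = c *\<^sub>C B (j a)" for c a using B_j_clinear by (simp add: bounded_clinear_def)
  ultimately show "bounded_clinear (\<lambda>p. snd p - B (j (fst p)))" "bounded_clinear (\<lambda>p :: 'y \<times> 'x. j (fst p))"
    by (auto simp: bounded_clinear_def scaleC_prod_def scaleC.scale_right_diff_distrib j_scaleC
        intro: bounded_linear_sub bounded_linear_snd)
qed

lemma solution_growth: "solution x z \<in> growth_space w"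
proof -
  obtain C where C: "continuous_on UNIV (\<lambda>t. snd (T t (0, x)) - B (j (fst (T t (0, x)))))"
      "\<And>t. norm (snd (T t (0, x)) - B (j (fst (T t (0, x))))) \<le> C * exp (w * \<bar>t\<bar>)"
    using T.clinear_image_growth[OF first_component_clinear] by blast
  obtain D where D: "continuous_on UNIV (\<lambda>t. j (fst (T t (0, z))))"
      "\<And>t. norm (j (fst (T t (0, z)))) \<le> D * exp (w * \<bar>t\<bar>)"
    using T.clinear_image_growth[OF second_component_clinear] by blast
  have "exp (- w * \<bar>t\<bar>) * norm (solution x z t) \<le> C + D" for t
  proof -
    have "norm (solution x z t) \<le> (C + D) * exp (w * \<bar>t\<bar>)"
      unfolding solution_def block12_def block22_def
      using norm_triangle_mono[OF C(2) D(2)] by (simp add: distrib_right)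
    then have "exp (- w * \<bar>t\<bar>) * norm (solution x z t) \<le> exp (- w * \<bar>t\<bar>) * ((C + D) * exp (w * \<bar>t\<bar>))"
      by (rule mult_left_mono) simp
    also have "\<dots> = C + D" by (simp add: exp_minus)
    finally show ?thesis .
  qed
  moreover have "continuous_on UNIV (solution x z)"
    using continuous_on_add[OF C(1) D(1)] by (simp add: solution_def[abs_def] block12_def block22_def)
  ultimately show ?thesis by (auto simp: growth_space_def intro!: bdd_aboveI2)
qed

text \<open>The group \<open>S\<close> is left general so that the computation serves both
  \<open>T\<close> and its reversal.\<close>

lemma laplace_clinear_orbit:
  fixes x z :: 'x
  assumes S: "exp_bounded_C0_group S M w" and l: "Re l > w"
  shows "laplace (\<lambda>t. snd (S t (0, x)) - B (j (fst (S t (0, x)))) + j (fst (S t (0, z)))) l =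
    (let v = laplace (\<lambda>t. S t (0, x)) l; v' = laplace (\<lambda>t. S t (0, z)) l
     in snd v - B (j (fst v)) + j (fst v'))"
proof -
  interpret S: exp_bounded_C0_group S M w by fact
  let ?F = "\<lambda>p. snd p - B (j (fst p))" and ?H = "\<lambda>p :: 'y \<times> 'x. j (fst p)"
  obtain C where C: "continuous_on UNIV (\<lambda>t. ?F (S t (0, x)))" "\<And>t. norm (?F (S t (0, x))) \<le> C * exp (w * \<bar>t\<bar>)"
    using S.clinear_image_growth[OF first_component_clinear] by blast
  obtain D where D: "continuous_on UNIV (\<lambda>t. ?H (S t (0, z)))" "\<And>t. norm (?H (S t (0, z))) \<le> D * exp (w * \<bar>t\<bar>)"
    using S.clinear_image_growth[OF second_component_clinear] by blast
  have "laplace (\<lambda>t. ?F (S t (0, x)) + ?H (S t (0, z))) l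
      = laplace (\<lambda>t. ?F (S t (0, x))) l + laplace (\<lambda>t. ?H (S t (0, z))) l"
  proof (rule laplace_add[OF _ _ _ _ l])
    show "norm (?F (S t (0, x))) \<le> C * exp (w * t)" "norm (?H (S t (0, z))) \<le> D * exp (w * t)"
      if "t \<ge> 0" for t using C(2)[of t] D(2)[of t] that by simp_all
  qed (use C(1) D(1) in \<open>auto intro: continuous_on_subset\<close>)
  also have "laplace (\<lambda>t. ?F (S t (0, x))) l = ?F (laplace (\<lambda>t. S t (0, x)) l)"
    by (rule laplace_bounded_clinear[OF S.orbit_continuous S.growth_nonneg l first_component_clinear])
  also have "laplace (\<lambda>t. ?H (S t (0, z))) l = ?H (laplace (\<lambda>t. S t (0, z)) l)"
    by (rule laplace_bounded_clinear[OF S.orbit_continuous S.growth_nonneg l second_component_clinear])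
  finally show ?thesis by (simp only: Let_def)
qed

lemma solution_is_LT_mild:
  "LT_mild_solution domA A B x y (solution x (2 *\<^sub>C B x + y))"
  unfolding LT_mild_solution_def
proof (intro exI conjI allI impI)
  show "solution x (2 *\<^sub>C B x + y) \<in> growth_space w" by (rule solution_growth)
  show "w < w + 1" by simp
  fix l assume "Re l > w + 1"
  then have l: "Re l > w" by simp
  let ?z = "2 *\<^sub>C B x + y"
  define p where "p z = j (fst (laplace (\<lambda>t. T t (0, z)) l))" for z
  define q where "q z = j (fst (laplace (\<lambda>t. T (- t) (0, z)) l))" for z
  have dom: "p z \<in> domA" "q z \<in> domA" for z
    unfolding p_def q_def by (rule resolvent_orbit[OF l])+
  then have dom': "c *\<^sub>C p z \<in> domA" "c *\<^sub>C q z \<in> domA" for c z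
    using A_subspace scaleC.subspace_scale by blast+
  have Q: "quad_pencil A B l (p z) = z" "quad_pencil A B (- l) (q z) = - z" for z
    unfolding p_def q_def by (rule resolvent_orbit[OF l])+
  \<comment> \<open>The relation \<open>snd v = l *\<^sub>C j (fst v) + B (j (fst v))\<close>
    cancels the term with \<open>B\<close>, leaving \<open>l *\<^sub>C p x\<close> from the first
    orbit; at \<open>- l\<close> the same happens with \<open>q\<close>.\<close>
  have 1: "laplace (solution x ?z) l = l *\<^sub>C p x + p ?z"
    using laplace_clinear_orbit[OF bound l, of x ?z] resolvent_orbit(2)[OF l, of x]
    by (simp add: solution_def[abs_def] block12_def block22_def p_def Let_def)
  have 2: "laplace (\<lambda>t. solution x ?z (- t)) l = (- l) *\<^sub>C q x + q ?z"
    using laplace_clinear_orbit[OF rev.exp_bounded_C0_group_axioms l, of x ?z] resolvent_orbit(5)[OF l, of x]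
    by (simp add: solution_def[abs_def] block12_def block22_def q_def Let_def)
  show "laplace (solution x ?z) l \<in> domA" "laplace (\<lambda>t. solution x ?z (- t)) l \<in> domA"
    unfolding 1 2 using A_subspace scaleC.subspace_add dom dom' by blast+
  show "quad_pencil A B l (laplace (solution x ?z) l) = l *\<^sub>C x + 2 *\<^sub>C B x + y"
    by (simp only: 1 quad_pencil_add[OF dom'(1) dom(1)] quad_pencil_scaleC[OF dom(1)] Q add.assoc)
  \<comment> \<open>Both signs combine: the pencil at \<open>- l\<close> maps
    \<open>(- l) *\<^sub>C q x\<close> to \<open>l *\<^sub>C x\<close> and \<open>q ?z\<close> to
    \<open>- ?z\<close>.\<close>
  show "quad_pencil A B (- l) (laplace (\<lambda>t. solution x ?z (- t)) l) = l *\<^sub>C x - 2 *\<^sub>C B x - y"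
    by (simp only: 2 quad_pencil_add[OF dom'(2) dom(2)] quad_pencil_scaleC[OF dom(2)] Q) simp
qed

section \<open>Uniqueness of mild solutions\<close>

lemma LT_mild_solution_unique:
  assumes f: "LT_mild_solution domA A B x y f" and g: "LT_mild_solution domA A B x y g"
  shows "f = g"
proof -
  obtain \<nu> \<nu>' where f: "f \<in> growth_space \<nu>" "\<nu> < \<nu>'"
      "\<And>l. Re l > \<nu>' \<Longrightarrow> laplace f l \<in> domA \<and> laplace (\<lambda>t. f (- t)) l \<in> domA \<and>
          quad_pencil A B l (laplace f l) = l *\<^sub>C x + 2 *\<^sub>C B x + y \<and>
          quad_pencil A B (- l) (laplace (\<lambda>t. f (- t)) l) = l *\<^sub>C x - 2 *\<^sub>C B x - y"
    using f unfolding LT_mild_solution_def by blast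
  obtain \<mu> \<mu>' where g: "g \<in> growth_space \<mu>" "\<mu> < \<mu>'"
      "\<And>l. Re l > \<mu>' \<Longrightarrow> laplace g l \<in> domA \<and> laplace (\<lambda>t. g (- t)) l \<in> domA \<and>
          quad_pencil A B l (laplace g l) = l *\<^sub>C x + 2 *\<^sub>C B x + y \<and>
          quad_pencil A B (- l) (laplace (\<lambda>t. g (- t)) l) = l *\<^sub>C x - 2 *\<^sub>C B x - y"
    using g unfolding LT_mild_solution_def by blast
  \<comment> \<open>Beyond \<open>m\<close> the pencil is injective at both signs and the equations
    of both solutions hold; \<open>m\<close> also dominates both growth exponents, so one rate
    serves for inverting the transforms.\<close>
  define m where "m = max w (max \<nu>' \<mu>')"
  have m: "\<nu> \<le> m" "\<mu> \<le> m" using f(2) g(2) by (auto simp: m_def)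
  have "laplace f (complex_of_real s) = laplace g (complex_of_real s)
      \<and> laplace (\<lambda>t. f (- t)) (complex_of_real s) = laplace (\<lambda>t. g (- t)) (complex_of_real s)" if "s > m" for s
  proof -
    have s: "Re (complex_of_real s) > w" "Re (complex_of_real s) > \<nu>'" "Re (complex_of_real s) > \<mu>'"
      using that by (auto simp: m_def)
    show ?thesis
      using f(3)[OF s(2)] g(3)[OF s(3)] by (auto intro: quad_pencil_inj[OF s(1)])
  qed
  \<comment> \<open>The transforms determine the functions only on the nonnegative half-line; the
    reflected functions cover the other half.\<close>
  then have "f t = g t" "f (- t) = g (- t)" if "t \<ge> 0" for t
    using growth_space_laplace_eqD[OF f(1) g(1) m _ that]
      growth_space_laplace_eqD[OF growth_space_reflect[OF f(1)] growth_space_reflect[OF g(1)] m _ that]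
    by blast+
  then have "f t = g t" for t by (cases "t \<ge> 0") (auto dest: spec[of _ "- t"], metis linear minus_minus neg_0_le_iff_le)
  then show ?thesis by blast
qed

end

theorem theorem3p9:
  fixes domA domB :: "'x::complex_banach set"
    and A B :: "'x \<Rightarrow> 'x"
    and j :: "'y::complex_banach \<Rightarrow> 'x"
    and T :: "real \<Rightarrow> 'y \<times> 'x \<Rightarrow> 'y \<times> 'x"
    and x y :: 'x
  assumes "closed_operator domA A"
    and "closed_operator domB B"
    and "resolvent_set domB B \<noteq> {}"
    and "continuous_embedding j"
    and "domA \<subseteq> {a \<in> domB. B a \<in> domB} \<inter> range j"
    and "B ` domA \<subseteq> range j"
    and "range j \<subseteq> domB"
    and "generates_C0_group (block_dom j domA) (block_op j A B) T"
    and "x \<in> domB"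
  shows "(\<exists>!u. LT_mild_solution domA A B x y u) \<and>
    LT_mild_solution domA A B x y
      (\<lambda>t. block22 T t x - B (j (block12 T t x)) + j (block12 T t (2 *\<^sub>C B x + y)))"
proof -
  have T: "C0_group T" using assms by (simp add: generates_C0_group_def)
  obtain M w where "\<And>t z. norm (T t z) \<le> M * exp (w * \<bar>t\<bar>) * norm z" "M \<ge> 1" "w \<ge> 0"
    using C0_group_growth_bound[OF T] by blast
  with T have "exp_bounded_C0_group T M w" by unfold_locales
  with assms interpret block_generator domA domB A B j T M w
    by unfold_locales (auto simp: closed_operator_def exp_bounded_C0_group_def)
  have "LT_mild_solution domA A B x y
      (\<lambda>t. block22 T t x - B (j (block12 T t x)) + j (block12 T t (2 *\<^sub>C B x + y)))"
    using solution_is_LT_mild[of x y] by (simp only: solution_def[abs_def])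
  then show ?thesis using LT_mild_solution_unique by blast
qed

end
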